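(* Let $d\ge1$ and $n\ge1$ be integers and let $f:\mathbb{R}^d\to\mathbb{R}$ be $n+1$ times continuously differentiable. Suppose there exist constants $A,B,D>0$ such that $A\le f(\vec x)\le B$ and $|\vec\nabla f(\vec x)|\le D|f(\vec x)|$ for all $\vec x$. Let $Qf$ be the quasi-interpolant of $f$ using degree $n$ B-splines on each axis on a mesh consisting of $d$-dimensional cubes with side length $h$, and let $R=D^n_\xi$ be the parameter hyperrectangle. Then for all $\vec x,\vec y$ (in $R$), $$|\log Qf(\vec x)-\log Qf(\vec y)|\le M'(n,h)\,|\vec x-\vec y|\qquad\text{with}\quad M'(n,h)=\frac{DB+C_1h^n}{A-C_2h^{n+1}},$$ where $$C_1=\sqrt d\left(C_{BH,1}(2n+1)^n d^{n/2}+2\|Q\|\,C_{BH,0}(2n+1)^{n+1}d^{(n+1)/2}\right)|f|_{W^{n+1}_\infty(R)},$$ $$C_2=c(n,d)\,\|Q\|\,(2n+1)^{n+1}\sum_{v=1}^d\|\partial_v^{\,n+1}f\|_\infty ,$$ with $C_{BH,0},C_{BH,1},c(n,d),\|Q\|$ and the norms specified in the context.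
   Context: One-dimensional B-splines: for a knot sequence without repeated knots, $b^0_k(x)=1$ if $\xi_k\le x<\xi_{k+1}$ and $0$ otherwise, and for $n\ge1$ $$b^n_k=\gamma^n_k\, b^{n-1}_k+(1-\gamma^n_{k+1})\,b^{n-1}_{k+1},\qquad \gamma^n_k(x)=\frac{x-\xi_k}{\xi_{k+n}-\xi_k}.$$ The support of $b^n_k$ is $[\xi_k,\xi_{k+n+1}]$. The parameter interval is the maximal interval on which the $b^n_k$ form a partition of unity (for a finite sequence, remove the $n$ leftmost and $n$ rightmost knot intervals; for a bi-infinite sequence, $\mathbb{R}$). Each axis $i$ of $\mathbb{R}^d$ carries a (finite or bi-infinite) uniform knot sequence $\{\xi^{(i)}_k\}$ of spacing $h>0$ with nondegenerate parameter interval. For $k=(k_1,\dots,k_d)$, $b_k(\vec x)=\prod_{i=1}^d b^n_{k_i}(x_i)$, with $b^n_{k_i}$ the degree $n$ B-splines on axis $i$. The parameter hyperrectangle $R=D^n_\xi$ is the product of the parameter intervals. Quasi-interpolant: $Qf=\sum_k(Q_kf)b_k$ with $$Q_kf=\sum_{v\in\{0,\dots,n\}^d} w_{v_1}\cdots w_{v_d}\, f\big(\xi^{(1)}_{k_1+v_1}+h/2,\dots,\xi^{(d)}_{k_d+v_d}+h/2\big),$$ where $w_0,\dots,w_n$ solve $\sum_{v=0}^n w_v(v-j)^n=\prod_{i=1}^n(i-j-\tfrac12)$ for $j=0,\dots,n$. The constant $\|Q\|=\sum_{v\in\{0,\dots,n\}^d}|w_{v_1}\cdots w_{v_d}|$.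 Constants: for $j\in\{0,1\}$, $$C_{BH,j}=\#\{\alpha\in\mathbb{Z}_{\ge0}^d:|\alpha|=j\}\,(n+1-j)\left(\sum_{|\beta|=n+1-j}(\beta!)^{-2}\right)^{1/2}$$ (sums over multi-indices in $\mathbb{Z}_{\ge0}^d$). Let $p_0,\dots,p_n$ be an orthonormal basis, in $L^2([0,1])$, of the polynomials of degree at most $n$ on $[0,1]$, and set $$c_1(n)=\sum_{k=0}^n\left(\int_0^1|p_k|\,dx\right)\|p_k\|_{\infty,[0,1]},\quad c_2(n)=\frac{1+c_1(n)}{2^n(n+1)!},\quad c(n,d)=c_2(n)\sum_{v=1}^d c_1(n)^{v-1},$$ where $\|\cdot\|_{\infty,[0,1]}$ is the supremum norm on $[0,1]$. Norms: $|\cdot|$ on vectors is the Euclidean norm, $\|\cdot\|_\infty$ in $C_2$ is the supremum norm over $R$, and $|f|_{W^{n+1}_\infty(R)}=\sum_{|\alpha|=n+1}\|D^\alpha f\|_{L^\infty(R)}$.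
   Formalization: The derivative norms in C_1 and C_2 are taken over the whole mesh rectangle (hull of all knots; equal to R if all knot sequences are bi-infinite) instead of R, since the claim fails otherwise for finite knots; and C_2 h^{n+1} < A is assumed so that the denominator is positive. *)

theory Defs
  imports "HOL-Probability.Essential_Supremum" "HOL-Computational_Algebra.Polynomial"
begin

section \<open>Partial derivatives and multi-indices\<close>

definition partial_deriv :: "'d::finite \<Rightarrow> (real ^ 'd \<Rightarrow> real) \<Rightarrow> real ^ 'd \<Rightarrow> real" where
  "partial_deriv i f x = frechet_derivative f (at x) (axis i 1)"

definition gradient :: "(real ^ 'd::finite \<Rightarrow> real) \<Rightarrow> real ^ 'd \<Rightarrow> real ^ 'd" where
  "gradient f x = (\<chi> i. partial_deriv i f x)"

primrec times_cont_diff :: "nat \<Rightarrow> (real ^ 'd::finite \<Rightarrow> real) \<Rightarrow> bool" where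
  "times_cont_diff 0 f \<longleftrightarrow> continuous_on UNIV f"
| "times_cont_diff (Suc m) f \<longleftrightarrow>
     (\<forall>x. f differentiable at x) \<and> (\<forall>i. times_cont_diff m (partial_deriv i f))"

definition multi_indices :: "nat \<Rightarrow> ('d::finite \<Rightarrow> nat) set" where
  "multi_indices m = {\<alpha>. (\<Sum>i\<in>UNIV. \<alpha> i) = m}"

definition multi_fact :: "('d::finite \<Rightarrow> nat) \<Rightarrow> real" where
  "multi_fact \<beta> = (\<Prod>i\<in>UNIV. fact (\<beta> i))"

text \<open>The axis \<open>i\<close> is differentiated \<open>\<alpha> i\<close> times, in some fixed order; for functions that are
  \<open>|\<alpha>|\<close> times continuously differentiable the order does not matter.\<close>

definition multi_deriv ::
    "('d::finite \<Rightarrow> nat) \<Rightarrow> (real ^ 'd \<Rightarrow> real) \<Rightarrow> real ^ 'd \<Rightarrow> real" where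
  "multi_deriv \<alpha> f = foldr partial_deriv (SOME is. \<forall>i. count_list is i = \<alpha> i) f"

section \<open>Norms\<close>

text \<open>Norms take values in the extended reals, since the domain is unbounded when a knot
  sequence is bi-infinite. The essential supremum is with respect to Lebesgue measure on \<open>S\<close>.\<close>

definition sup_norm :: "(real ^ 'd::finite) set \<Rightarrow> (real ^ 'd \<Rightarrow> real) \<Rightarrow> ereal" where
  "sup_norm S g = (SUP x\<in>S. ereal \<bar>g x\<bar>)"

definition Linf_norm :: "(real ^ 'd::finite) set \<Rightarrow> (real ^ 'd \<Rightarrow> real) \<Rightarrow> ereal" where
  "Linf_norm S g = esssup (lebesgue_on S) (\<lambda>x. ereal \<bar>g x\<bar>)"

definition W_inf_seminorm ::
    "nat \<Rightarrow> (real ^ 'd::finite) set \<Rightarrow> (real ^ 'd \<Rightarrow> real) \<Rightarrow> ereal" where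
  "W_inf_seminorm m S f = (\<Sum>\<alpha>\<in>multi_indices m. Linf_norm S (multi_deriv \<alpha> f))"

section \<open>Knot sequences and B-splines\<close>

text \<open>A knot sequence consists of an index set \<open>K\<close> and the knots \<open>\<xi> k\<close> for \<open>k \<in> K\<close>; values of \<open>\<xi>\<close>
  outside \<open>K\<close> are irrelevant.\<close>

definition uniform_knots :: "real \<Rightarrow> int set \<Rightarrow> (int \<Rightarrow> real) \<Rightarrow> bool" where
  "uniform_knots h K \<xi> \<longleftrightarrow>
     (K = UNIV \<or> (\<exists>a b. a \<le> b \<and> K = {a..b})) \<and>
     (\<forall>k. k \<in> K \<and> k + 1 \<in> K \<longrightarrow> \<xi> (k + 1) = \<xi> k + h)"

definition knot_ratio :: "(int \<Rightarrow> real) \<Rightarrow> nat \<Rightarrow> int \<Rightarrow> real \<Rightarrow> real" where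
  "knot_ratio \<xi> n k x = (x - \<xi> k) / (\<xi> (k + int n) - \<xi> k)"

primrec bspline :: "(int \<Rightarrow> real) \<Rightarrow> nat \<Rightarrow> int \<Rightarrow> real \<Rightarrow> real" where
  "bspline \<xi> 0 k x = (if \<xi> k \<le> x \<and> x < \<xi> (k + 1) then 1 else 0)"
| "bspline \<xi> (Suc n) k x =
     knot_ratio \<xi> (Suc n) k x * bspline \<xi> n k x +
     (1 - knot_ratio \<xi> (Suc n) (k + 1) x) * bspline \<xi> n (k + 1) x"

definition bspline_indices :: "nat \<Rightarrow> int set \<Rightarrow> int set" where
  "bspline_indices n K = {k. k \<in> K \<and> k + int n + 1 \<in> K}"

definition knot_hull :: "int set \<Rightarrow> (int \<Rightarrow> real) \<Rightarrow> real set" where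
  "knot_hull K \<xi> = (\<Union>k\<in>{k. k \<in> K \<and> k + 1 \<in> K}. {\<xi> k..\<xi> (k + 1)})"

text \<open>The union of the knot intervals that have \<open>n\<close> further knot intervals on either side.\<close>

definition parameter_interval :: "nat \<Rightarrow> int set \<Rightarrow> (int \<Rightarrow> real) \<Rightarrow> real set" where
  "parameter_interval n K \<xi> =
     (\<Union>k\<in>{k. k - int n \<in> K \<and> k + 1 + int n \<in> K}. {\<xi> k..\<xi> (k + 1)})"

lemma uniform_knots_diff:
  assumes "\<And>k. a \<le> k \<Longrightarrow> k < b \<Longrightarrow> \<xi> (k + 1) = \<xi> k + (h::real)" "a \<le> (k::int)" "k \<le> b"
  shows "\<xi> k = \<xi> a + of_int (k - a) * h"
  using assms(2,3)
proof (induction k rule: int_ge_induct)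
  case (step i)
  then show ?case using assms(1)[of i] by (simp add: algebra_simps)
qed simp

lemma parameter_interval_finite:
  assumes "uniform_knots h {a..b} \<xi>" "h > 0" "a + int n < b - int n"
  shows "parameter_interval n {a..b} \<xi> = {\<xi> (a + int n)..\<xi> (b - int n)}"
proof -
  have e: "\<xi> k = \<xi> a + of_int (k - a) * h" if "a \<le> k" "k \<le> b" for k
    using that assms(1) by (intro uniform_knots_diff[where b = b]) (auto simp: uniform_knots_def)
  show ?thesis
  proof (intro equalityI subsetI)
    fix x assume "x \<in> parameter_interval n {a..b} \<xi>"
    then obtain k where k: "a \<le> k - int n" "k + 1 + int n \<le> b" "\<xi> k \<le> x" "x \<le> \<xi> (k + 1)"
      by (auto simp: parameter_interval_def)
    have "of_int (int n) * h \<le> of_int (k - a) * h"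
      "of_int (k + 1 - a) * h \<le> of_int (b - int n - a) * h"
      using k assms(2) by (intro mult_right_mono; linarith)+
    then show "x \<in> {\<xi> (a + int n)..\<xi> (b - int n)}"
      using k assms(3) e[of k] e[of "k + 1"] e[of "a + int n"] e[of "b - int n"] by simp
  next
    fix x assume x: "x \<in> {\<xi> (a + int n)..\<xi> (b - int n)}"
    define k where "k = min (b - int n - 1) (a + \<lfloor>(x - \<xi> a) / h\<rfloor>)"
    have xa: "\<xi> a + of_int (int n) * h \<le> x" "x \<le> \<xi> a + of_int (b - int n - a) * h"
      using x assms(3) e[of "a + int n"] e[of "b - int n"] by auto
    have "of_int (int n) \<le> (x - \<xi> a) / h"
      using xa assms(2) by (simp add: field_simps)
    then have n: "int n \<le> \<lfloor>(x - \<xi> a) / h\<rfloor>" by linarith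
    have k: "a + int n \<le> k" "k + 1 \<le> b - int n" using n assms(3) by (auto simp: k_def)
    have "of_int (k - a) \<le> (x - \<xi> a) / h" by (simp add: k_def) linarith
    then have 1: "\<xi> k \<le> x" using k e[of k] assms(2) by (simp add: field_simps)
    have "(x - \<xi> a) / h \<le> of_int (k + 1 - a)"
    proof (cases "k = b - int n - 1")
      case True
      then have "k + 1 - a = b - int n - a" by simp
      then show ?thesis using xa assms(2) by (simp only: pos_divide_le_eq)
    next
      case False
      then have "k = a + \<lfloor>(x - \<xi> a) / h\<rfloor>" by (auto simp: k_def)
      then show ?thesis by simp
    qed
    then have 2: "x \<le> \<xi> (k + 1)" using k e[of "k + 1"] assms(2) by (simp add: field_simps)
    show "x \<in> parameter_interval n {a..b} \<xi>"
      using 1 2 k by (auto simp: parameter_interval_def intro!: exI[of _ k])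
  qed
qed

lemma parameter_interval_infinite:
  assumes "uniform_knots h UNIV \<xi>" "h > 0"
  shows "parameter_interval n UNIV \<xi> = UNIV"
proof -
  have "\<exists>k. \<xi> k \<le> x \<and> x \<le> \<xi> (k + 1)" for x
  proof -
    obtain m :: nat where m: "\<bar>x - \<xi> 0\<bar> / h + real n + 1 < real m"
      using reals_Archimedean2 by blast
    define N where "N = int m + int n + 1"
    have fin: "uniform_knots h {-N..N} \<xi>"
      using assms by (auto simp: uniform_knots_def N_def intro!: exI[of _ "-N"] exI[of _ N])
    have e: "\<xi> k = \<xi> (-N) + of_int (k + N) * h" if "-N \<le> k" "k \<le> N" for k
      using uniform_knots_diff[of "-N" N \<xi> h k] that assms(1) by (simp add: uniform_knots_def)
    have "\<bar>x - \<xi> 0\<bar> / h \<le> real m" using m by linarith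
    then have b: "\<bar>x - \<xi> 0\<bar> \<le> real m * h" using assms(2) by (simp add: pos_divide_le_eq)
    have lt: "-N + int n < N - int n" by (simp add: N_def)
    have "\<xi> (-N + int n) = \<xi> 0 - (real m + 1) * h" "\<xi> (N - int n) = \<xi> 0 + (real m + 1) * h"
      using e[of "-N + int n"] e[of 0] e[of "N - int n"] by (simp_all add: N_def algebra_simps)
    then have "x \<in> {\<xi> (-N + int n)..\<xi> (N - int n)}"
      using b assms(2) by (simp add: abs_le_iff algebra_simps)
    then have "x \<in> parameter_interval n {-N..N} \<xi>"
      using parameter_interval_finite[OF fin assms(2) lt] by simp
    then show ?thesis by (auto simp: parameter_interval_def)
  qed
  then show ?thesis by (auto simp: parameter_interval_def)
qed

text \<open>Tensor products: axis \<open>i\<close> carries the knots \<open>\<xi> i\<close> with index set \<open>K i\<close>.\<close>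

definition box_product :: "('d::finite \<Rightarrow> real set) \<Rightarrow> (real ^ 'd) set" where
  "box_product I = {x. \<forall>i. x $ i \<in> I i}"

definition parameter_rectangle ::
    "nat \<Rightarrow> ('d::finite \<Rightarrow> int set) \<Rightarrow> ('d \<Rightarrow> int \<Rightarrow> real) \<Rightarrow> (real ^ 'd) set" where
  "parameter_rectangle n K \<xi> = box_product (\<lambda>i. parameter_interval n (K i) (\<xi> i))"

text \<open>The functionals of the B-splines that do not vanish on the parameter rectangle sample \<open>f\<close> up
  to \<open>n\<close> mesh cells outside it, but always inside the mesh rectangle. Error bounds on the
  parameter rectangle therefore involve the derivatives of \<open>f\<close> on the mesh rectangle. The two
  rectangles agree when all knot sequences are bi-infinite.\<close>

definition mesh_rectangle ::
    "('d::finite \<Rightarrow> int set) \<Rightarrow> ('d \<Rightarrow> int \<Rightarrow> real) \<Rightarrow> (real ^ 'd) set" where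
  "mesh_rectangle K \<xi> = box_product (\<lambda>i. knot_hull (K i) (\<xi> i))"

definition tensor_bspline ::
    "('d::finite \<Rightarrow> int \<Rightarrow> real) \<Rightarrow> nat \<Rightarrow> ('d \<Rightarrow> int) \<Rightarrow> real ^ 'd \<Rightarrow> real" where
  "tensor_bspline \<xi> n k x = (\<Prod>i\<in>UNIV. bspline (\<xi> i) n (k i) (x $ i))"

lemma mesh_rectangle_infinite:
  assumes "\<And>i. uniform_knots h (K i) (\<xi> i)" "h > 0" "\<And>i. K i = UNIV"
  shows "parameter_rectangle n K \<xi> = UNIV" "mesh_rectangle K \<xi> = UNIV"
proof -
  have P: "parameter_interval m (K i) (\<xi> i) = UNIV" for m i
    using parameter_interval_infinite[of h "\<xi> i" m] assms by simp
  have "knot_hull (K i) (\<xi> i) = parameter_interval 0 (K i) (\<xi> i)" for i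
    by (simp add: knot_hull_def parameter_interval_def)
  then show "parameter_rectangle n K \<xi> = UNIV" "mesh_rectangle K \<xi> = UNIV"
    by (simp_all add: parameter_rectangle_def mesh_rectangle_def box_product_def P)
qed

section \<open>The quasi-interpolant\<close>

definition quasi_weights :: "nat \<Rightarrow> (nat \<Rightarrow> real) \<Rightarrow> bool" where
  "quasi_weights n w \<longleftrightarrow>
     (\<forall>j\<le>n. (\<Sum>v=0..n. w v * (real v - real j) ^ n) = (\<Prod>i=1..n. real i - real j - 1/2))"

definition quasi_functional ::
    "real \<Rightarrow> nat \<Rightarrow> (nat \<Rightarrow> real) \<Rightarrow> ('d::finite \<Rightarrow> int \<Rightarrow> real) \<Rightarrow> ('d \<Rightarrow> int) \<Rightarrow>
      (real ^ 'd \<Rightarrow> real) \<Rightarrow> real" where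
  "quasi_functional h n w \<xi> k f =
     (\<Sum>v\<in>{v. \<forall>i. v i \<le> n}. (\<Prod>i\<in>UNIV. w (v i)) * f (\<chi> i. \<xi> i (k i + int (v i)) + h / 2))"

text \<open>For bi-infinite knot sequences the sum is infinite, but at each point only finitely many
  terms are nonzero.\<close>

definition quasi_interpolant ::
    "real \<Rightarrow> nat \<Rightarrow> (nat \<Rightarrow> real) \<Rightarrow> ('d::finite \<Rightarrow> int set) \<Rightarrow> ('d \<Rightarrow> int \<Rightarrow> real) \<Rightarrow>
      (real ^ 'd \<Rightarrow> real) \<Rightarrow> real ^ 'd \<Rightarrow> real" where
  "quasi_interpolant h n w K \<xi> f x =
     (\<Sum>\<^sub>\<infinity>k\<in>{k. \<forall>i. k i \<in> bspline_indices n (K i)}.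
        quasi_functional h n w \<xi> k f * tensor_bspline \<xi> n k x)"

definition quasi_norm :: "'d::finite itself \<Rightarrow> nat \<Rightarrow> (nat \<Rightarrow> real) \<Rightarrow> real" where
  "quasi_norm _ n w = (\<Sum>v\<in>{v::'d \<Rightarrow> nat. \<forall>i. v i \<le> n}. \<bar>\<Prod>i\<in>UNIV. w (v i)\<bar>)"

section \<open>Constants\<close>

definition C_BH :: "'d::finite itself \<Rightarrow> nat \<Rightarrow> nat \<Rightarrow> real" where
  "C_BH _ n j =
     real (card (multi_indices j :: ('d \<Rightarrow> nat) set)) * real (n + 1 - j) *
     sqrt (\<Sum>\<beta>\<in>(multi_indices (n + 1 - j) :: ('d \<Rightarrow> nat) set). 1 / (multi_fact \<beta>)\<^sup>2)"

definition orthonormal_poly_basis :: "nat \<Rightarrow> (nat \<Rightarrow> real poly) \<Rightarrow> bool" where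
  "orthonormal_poly_basis n p \<longleftrightarrow>
     (\<forall>k\<le>n. degree (p k) \<le> n) \<and>
     (\<forall>j\<le>n. \<forall>k\<le>n. integral {0..1} (\<lambda>x. poly (p j) x * poly (p k) x) = (if j = k then 1 else 0)) \<and>
     (\<forall>q. degree q \<le> n \<longrightarrow> (\<exists>a. q = (\<Sum>k\<le>n. smult (a k) (p k))))"

definition c1_const :: "nat \<Rightarrow> (nat \<Rightarrow> real poly) \<Rightarrow> real" where
  "c1_const n p =
     (\<Sum>k\<le>n. integral {0..1} (\<lambda>x. \<bar>poly (p k) x\<bar>) * (SUP x\<in>{0..1}. \<bar>poly (p k) x\<bar>))"

definition c2_const :: "nat \<Rightarrow> (nat \<Rightarrow> real poly) \<Rightarrow> real" where
  "c2_const n p = (1 + c1_const n p) / (2 ^ n * fact (n + 1))"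

definition c_const :: "nat \<Rightarrow> nat \<Rightarrow> (nat \<Rightarrow> real poly) \<Rightarrow> real" where
  "c_const n d p = c2_const n p * (\<Sum>v=1..d. c1_const n p ^ (v - 1))"

definition C1 ::
    "nat \<Rightarrow> (nat \<Rightarrow> real) \<Rightarrow> (real ^ 'd::finite) set \<Rightarrow> (real ^ 'd \<Rightarrow> real) \<Rightarrow> ereal" where
  "C1 n w S f =
     ereal (sqrt (real CARD('d)) *
       (C_BH TYPE('d) n 1 * real (2 * n + 1) ^ n * real CARD('d) powr (real n / 2) +
        2 * quasi_norm TYPE('d) n w * C_BH TYPE('d) n 0 * real (2 * n + 1) ^ (n + 1) *
          real CARD('d) powr (real (n + 1) / 2))) *
     W_inf_seminorm (n + 1) S f"

definition C2 ::
    "nat \<Rightarrow> (nat \<Rightarrow> real) \<Rightarrow> (nat \<Rightarrow> real poly) \<Rightarrow> (real ^ 'd::finite) set \<Rightarrow>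
      (real ^ 'd \<Rightarrow> real) \<Rightarrow> ereal" where
  "C2 n w p S f =
     ereal (c_const n CARD('d) p * quasi_norm TYPE('d) n w * real (2 * n + 1) ^ (n + 1)) *
     (\<Sum>v\<in>UNIV. sup_norm S ((partial_deriv v ^^ (n + 1)) f))"

end

theory Submission
  imports Defs
begin

text \<open>
  On \<open>[m, \<infinity>)\<close> the logarithm has Lipschitz constant \<open>1 / m\<close>. It therefore suffices to bound
  \<open>Q f\<close> below by \<open>A - C\<^sub>2 h\<^bsup>n + 1\<^esup>\<close> and its Lipschitz constant above by \<open>D B + C\<^sub>1 h\<^sup>n\<close>. As
  \<open>A \<le> f\<close>, and as \<open>D B\<close> bounds the gradient of \<open>f\<close>, both follow from two estimates for the error
  \<open>f - Q f\<close> on the parameter rectangle: it is at most \<open>C\<^sub>2 h\<^bsup>n + 1\<^esup>\<close>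
  (\<open>quasi_interpolant_error\<close>) and has Lipschitz constant \<open>C\<^sub>1 h\<^sup>n\<close>
  (\<open>quasi_interpolant_error_lipschitz\<close>).

  In one variable the weights are dual to Marsden's identity, so that quasi-interpolation
  reproduces polynomials of degree at most \<open>n\<close> (\<open>local_quasi_power\<close>). On a knot interval it samples
  only points at distance at most \<open>(n + 1/2) h\<close> from the midpoint. Subtracting from \<open>f\<close> its Taylor
  polynomial at the midpoint changes nothing in the error, and leaves a function bounded by
  \<open>M ((n + 1/2) h)\<^bsup>n + 1\<^esup> / (n + 1)!\<close> where \<open>M\<close> bounds the derivative of order \<open>n + 1\<close>.
  Quasi-interpolation multiplies a sup-norm bound by at most \<open>\<Sum>v. \<bar>w v\<bar>\<close>, because B-splines are
  nonnegative and sum to one, and the slope of a spline is at most \<open>2 / h\<close> times the bound of its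
  coefficients (\<open>spline_lipschitz\<close>).

  In several variables \<open>Q\<close> is a composition of commuting one-variable operators \<open>Q\<^sub>i\<close>, and
  \<open>f - Q\<^sub>i (Q' f) = (f - Q\<^sub>i f) + Q\<^sub>i (f - Q' f)\<close> adds the errors of the axes up, each multiplied by at
  most a power of \<open>\<Sum>v. \<bar>w v\<bar>\<close>, whose power with exponent \<open>d\<close> is \<open>\<parallel>Q\<parallel>\<close>. For the slope in direction \<open>i\<close> the
  operator \<open>Q\<^sub>i\<close> is taken as the outermost one: the first summand then has slope of order \<open>h\<^sup>n\<close> by
  the one-variable estimate, and the second is a spline in \<open>x\<^sub>i\<close> with coefficients of order
  \<open>h\<^bsup>n + 1\<^esup>\<close>. Each axis contributes the pure derivative of order \<open>n + 1\<close> in its direction, and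
  the seminorm in \<open>C\<^sub>1\<close> dominates the sum of their suprema. The constants so obtained are at most
  the stated ones, because \<open>c(n, d) \<ge> 1 / (2\<^sup>n (n + 1)!)\<close> and \<open>C\<^bsub>BH, j\<^esub> \<ge> 1 / (n - j)!\<close>.
\<close>

section \<open>Cardinal B-splines\<close>

text \<open>The B-spline with knots \<open>0, 1, \<dots>, n + 1\<close>. Over uniform knots every B-spline is obtained from it
  by an affine substitution, so that the analysis can take place over the integers.\<close>

primrec cardinal_bspline :: "nat \<Rightarrow> real \<Rightarrow> real" where
  "cardinal_bspline 0 t = (if 0 \<le> t \<and> t < 1 then 1 else 0)"
| "cardinal_bspline (Suc n) t =
     (t * cardinal_bspline n t + (real n + 2 - t) * cardinal_bspline n (t - 1)) / (real n + 1)"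

lemma cardinal_bspline_support:
  "t < 0 \<or> real n + 1 \<le> t \<Longrightarrow> cardinal_bspline n t = 0"
  by (induction n arbitrary: t) auto

lemma cardinal_bspline_nonneg: "0 \<le> cardinal_bspline n t"
proof (induction n arbitrary: t)
  case (Suc n)
  have "0 \<le> t * cardinal_bspline n t"
    using Suc cardinal_bspline_support[of t n] by (cases "t < 0") auto
  moreover have "0 \<le> (real n + 2 - t) * cardinal_bspline n (t - 1)"
    using Suc cardinal_bspline_support[of "t - 1" n] by (cases "real n + 2 \<le> t") auto
  ultimately show ?case by simp
qed simp

lemma cardinal_bspline_at_zero:
  assumes "1 \<le> n" shows "cardinal_bspline n 0 = 0"
proof -
  obtain m where "n = Suc m" using assms by (cases n) auto
  then show ?thesis using cardinal_bspline_support[of "-1" m] by simp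
qed

lemma cardinal_bspline_1: "cardinal_bspline (Suc 0) t = max 0 (min t (2 - t))"
  by auto

lemma continuous_on_cardinal_bspline:
  "1 \<le> n \<Longrightarrow> continuous_on UNIV (cardinal_bspline n)"
proof (induction n rule: dec_induct)
  case base
  show ?case unfolding One_nat_def cardinal_bspline_1 by (intro continuous_intros)
next
  case (step n)
  have "continuous_on UNIV (\<lambda>t. cardinal_bspline n (t - 1))"
    by (rule continuous_on_compose2[OF step.IH]) (auto intro!: continuous_intros)
  then show ?case using step.IH by (auto intro!: continuous_intros)
qed

text \<open>The B-splines of degree \<open>1\<close> have kinks at the integers.\<close>

lemma DERIV_cardinal_bspline:
  assumes "t \<notin> \<int>"
  shows "(cardinal_bspline (Suc n) has_real_derivative
            cardinal_bspline n t - cardinal_bspline n (t - 1)) (at t)"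
  using assms
proof (induction n arbitrary: t)
  have loc: "eventually (\<lambda>s. (0 \<le> s \<and> s < 1) = (0 \<le> t \<and> t < 1)) (nhds t)" if "t \<notin> \<int>" for t :: real
  proof -
    have "t \<noteq> 0" "t \<noteq> 1" using that by auto
    then consider "t < 0" | "0 < t" "t < 1" | "1 < t" by linarith
    then show ?thesis
    proof cases
      case 1
      then have "eventually (\<lambda>s. s \<in> {..<0}) (nhds t)" by (intro eventually_nhds_in_open) auto
      then show ?thesis by eventually_elim (use 1 in auto)
    next
      case 2
      then have "eventually (\<lambda>s. s \<in> {0<..<1}) (nhds t)" by (intro eventually_nhds_in_open) auto
      then show ?thesis by eventually_elim (use 2 in auto)
    next
      case 3
      then have "eventually (\<lambda>s. s \<in> {1<..}) (nhds t)" by (intro eventually_nhds_in_open) auto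
      then show ?thesis by eventually_elim (use 3 in auto)
    qed
  qed
  have const: "(cardinal_bspline 0 has_real_derivative 0) (at t)" if "t \<notin> \<int>" for t :: real
  proof -
    have "eventually (\<lambda>s. cardinal_bspline 0 s = cardinal_bspline 0 t) (nhds t)"
      using loc[OF that] by eventually_elim simp
    then show ?thesis by (subst DERIV_cong_ev[OF refl _ refl]) auto
  qed
  have shift: "((\<lambda>s. s - 1) has_real_derivative 1) (at t)" for t :: real
    by (auto intro!: derivative_eq_intros)
  have rec: "((\<lambda>s. (s * f s + (a - s) * f (s - 1)) / b) has_real_derivative
      (f t + t * f' - f (t - 1) + (a - t) * g') / b) (at t)"
    if "(f has_real_derivative f') (at t)" "((\<lambda>s. f (s - 1)) has_real_derivative g') (at t)"
    for f f' g' a b and t :: real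
    unfolding divide_inverse
    by (rule DERIV_cmult_right) (auto intro!: derivative_eq_intros that)
  {
    case 0
    have t1: "t - 1 \<notin> \<int>" using 0 by (metis Ints_1 Ints_add diff_add_cancel)
    have "((\<lambda>s. cardinal_bspline 0 (s - 1)) has_real_derivative 0) (at t)"
      using DERIV_chain2[where f = "cardinal_bspline 0" and g = "\<lambda>s. s - 1", OF const[OF t1] shift]
      by (simp only: mult_zero_left)
    from rec[OF const[OF 0] this, of 2 1] show ?case
      by (simp del: cardinal_bspline.simps(1) add: cardinal_bspline.simps(2)[of 0, abs_def])
  next
    case (Suc n)
    have t1: "t - 1 \<notin> \<int>" using Suc(2) by (metis Ints_1 Ints_add diff_add_cancel)
    have d1: "((\<lambda>s. cardinal_bspline (Suc n) (s - 1)) has_real_derivative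
        cardinal_bspline n (t - 1) - cardinal_bspline n (t - 1 - 1)) (at t)"
      using DERIV_chain2[where f = "cardinal_bspline (Suc n)" and g = "\<lambda>s. s - 1", OF Suc.IH[OF t1] shift]
      by (simp only: mult_1_right)
    let ?N = "cardinal_bspline n" and ?M = "cardinal_bspline (Suc n)"
    note rec[OF Suc.IH[OF Suc(2)] d1, of "real (Suc n) + 2" "real (Suc n) + 1"]
    moreover have "t * (?N t - ?N (t - 1)) + (real (Suc n) + 2 - t) * (?N (t - 1) - ?N (t - 1 - 1))
        = (real n + 1) * (?M t - ?M (t - 1))"
    proof -
      have M: "(real n + 1) * ?M s = s * ?N s + (real n + 2 - s) * ?N (s - 1)" for s
        by simp
      show ?thesis unfolding right_diff_distrib[of _ "?M t"] M by (simp add: algebra_simps)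
    qed
    then have "(?M t + t * (?N t - ?N (t - 1)) - ?M (t - 1)
          + (real (Suc n) + 2 - t) * (?N (t - 1) - ?N (t - 1 - 1))) / (real (Suc n) + 1)
        = ?M t - ?M (t - 1)"
      by (simp del: cardinal_bspline.simps add: field_simps)
    ultimately show ?case
      by (simp only: cardinal_bspline.simps(2)[of "Suc n", abs_def])
  }
qed

text \<open>One step of de Boor's algorithm: the recursion trades a degree for new coefficients. Marsden's
  identity and the partition of unity follow by induction, since their coefficients are mapped to
  those of the lower degree.\<close>

lemma spline_sum_Suc:
  assumes "of_int j \<le> \<tau>" "\<tau> < of_int j + 1"
  shows "(\<Sum>k\<in>{j - int (Suc n)..j}. c k * cardinal_bspline (Suc n) (\<tau> - of_int k)) =
    (\<Sum>k\<in>{j - int n..j}. ((\<tau> - of_int k) * c k + (real n + 1 - \<tau> + of_int k) * c (k - 1)) / (real n + 1)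
        * cardinal_bspline n (\<tau> - of_int k))"
proof -
  let ?N = "\<lambda>k::int. cardinal_bspline n (\<tau> - of_int k)"
  let ?I = "{j - int (Suc n)..j}"
  let ?a = "\<lambda>k. c k * (\<tau> - of_int k) * ?N k" and ?b = "\<lambda>k. c (k - 1) * (real n + 1 - \<tau> + of_int k) * ?N k"
  have z1: "?N (j - int (Suc n)) = 0" and z2: "?N (j + 1) = 0"
    using assms by (auto intro!: cardinal_bspline_support)
  have "(\<Sum>k\<in>?I. c k * cardinal_bspline (Suc n) (\<tau> - of_int k)) =
      (\<Sum>k\<in>?I. (?a k + ?b (k + 1)) / (real n + 1))"
    by (intro sum.cong refl) (simp add: field_simps)
  also have "\<dots> = ((\<Sum>k\<in>?I. ?a k) + (\<Sum>k\<in>?I. ?b (k + 1))) / (real n + 1)"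
    by (simp only: sum_divide_distrib[symmetric] sum.distrib)
  also have "(\<Sum>k\<in>?I. ?a k) = (\<Sum>k\<in>{j - int n..j}. ?a k)"
  proof (rule sum.mono_neutral_right)
    show "\<forall>i\<in>?I - {j - int n..j}. ?a i = 0"
    proof
      fix i assume "i \<in> ?I - {j - int n..j}"
      then have "i = j - int (Suc n)" by auto
      then show "?a i = 0" using z1 by (simp only: mult_zero_right)
    qed
  qed auto
  also have "(\<Sum>k\<in>?I. ?b (k + 1)) = (\<Sum>k\<in>{j - int n..j + 1}. ?b k)"
    by (rule sum.reindex_bij_witness[of _ "\<lambda>k. k - 1" "\<lambda>k. k + 1"]) auto
  also have "\<dots> = (\<Sum>k\<in>{j - int n..j}. ?b k)"
  proof (rule sum.mono_neutral_right)
    show "\<forall>i\<in>{j - int n..j + 1} - {j - int n..j}. ?b i = 0"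
    proof
      fix i assume "i \<in> {j - int n..j + 1} - {j - int n..j}"
      then have "i = j + 1" by auto
      then show "?b i = 0" using z2 by (simp only: mult_zero_right)
    qed
  qed auto
  also have "((\<Sum>k\<in>{j - int n..j}. ?a k) + (\<Sum>k\<in>{j - int n..j}. ?b k)) / (real n + 1) =
      (\<Sum>k\<in>{j - int n..j}. (?a k + ?b k) / (real n + 1))"
    by (simp only: sum_divide_distrib[symmetric] sum.distrib)
  also have "\<dots> = (\<Sum>k\<in>{j - int n..j}. ((\<tau> - of_int k) * c k + (real n + 1 - \<tau> + of_int k) * c (k - 1)) / (real n + 1) * ?N k)"
    by (intro sum.cong refl) (simp add: field_simps)
  finally show ?thesis .
qed

lemma marsden_half_open:
  assumes "of_int j \<le> \<tau>" "\<tau> < of_int j + 1"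
  shows "(\<Sum>k\<in>{j - int n..j}. (\<Prod>i=1..n. of_int k + real i - t) * cardinal_bspline n (\<tau> - of_int k)) = (\<tau> - t) ^ n"
proof (induction n)
  case 0
  then show ?case using assms by simp
next
  case (Suc n)
  let ?\<psi> = "\<lambda>m k. \<Prod>i=1..m. of_int k + real i - t"
  have psi: "((\<tau> - of_int k) * ?\<psi> (Suc n) k + (real n + 1 - \<tau> + of_int k) * ?\<psi> (Suc n) (k - 1)) / (real n + 1)
      = (\<tau> - t) * ?\<psi> n k" for k :: int
  proof -
    have 1: "?\<psi> (Suc n) k = ?\<psi> n k * (of_int k + real n + 1 - t)"
      by (simp add: algebra_simps)
    have "?\<psi> (Suc n) (k - 1) = (\<Prod>i=0..n. of_int k + real i - t)"
      by (rule prod.reindex_bij_witness[of _ Suc "\<lambda>i. i - 1"]) (auto simp: of_nat_diff)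
    also have "\<dots> = (of_int k - t) * ?\<psi> n k"
      by (simp add: prod.atLeast_Suc_atMost)
    finally have 2: "?\<psi> (Suc n) (k - 1) = (of_int k - t) * ?\<psi> n k" .
    have "(\<tau> - of_int k) * ?\<psi> (Suc n) k + (real n + 1 - \<tau> + of_int k) * ?\<psi> (Suc n) (k - 1)
       = (real n + 1) * ((\<tau> - t) * ?\<psi> n k)"
      unfolding 1 2 by algebra
    then show ?thesis by (simp del: prod.cl_ivl_Suc)
  qed
  show ?case
    unfolding spline_sum_Suc[OF assms] psi mult.assoc sum_distrib_left[symmetric] Suc power_Suc ..
qed

lemma sum_cardinal_bspline_half_open:
  assumes "of_int j \<le> \<tau>" "\<tau> < of_int j + 1"
  shows "(\<Sum>k\<in>{j - int n..j}. cardinal_bspline n (\<tau> - of_int k)) = 1"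
proof (induction n)
  case 0
  then show ?case using assms by simp
next
  case (Suc n)
  have "((\<tau> - of_int k) * 1 + (real n + 1 - \<tau> + of_int k) * 1) / (real n + 1) = 1" for k :: int
    by simp
  then show ?case using spline_sum_Suc[OF assms, of "\<lambda>_. 1" n] Suc by (simp only: mult_1)
qed

text \<open>For \<open>n \<ge> 1\<close> the B-splines are continuous and vanish at the ends of their supports. The formulas
  for a half-open knot interval thus persist at its right end, which need not belong to another knot
  interval of the parameter interval.\<close>

lemma spline_sum_floor:
  assumes "1 \<le> n" "of_int j \<le> \<tau>" "\<tau> \<le> of_int j + 1"
  shows "(\<Sum>k\<in>{j - int n..j}. c k * cardinal_bspline n (\<tau> - of_int k)) =
    (\<Sum>k\<in>{\<lfloor>\<tau>\<rfloor> - int n..\<lfloor>\<tau>\<rfloor>}. c k * cardinal_bspline n (\<tau> - of_int k))"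
proof (cases "\<tau> = of_int j + 1")
  case True
  have z: "cardinal_bspline n (\<tau> - of_int (j - int n)) = 0" "cardinal_bspline n (\<tau> - of_int (j + 1)) = 0"
    using True assms cardinal_bspline_support[of "real n + 1" n] cardinal_bspline_at_zero[of n]
    by (simp_all add: algebra_simps)
  have f: "\<lfloor>\<tau>\<rfloor> = j + 1" using True by simp
  have "(\<Sum>k\<in>{j - int n..j}. c k * cardinal_bspline n (\<tau> - of_int k))
      = (\<Sum>k\<in>{j + 1 - int n..j}. c k * cardinal_bspline n (\<tau> - of_int k))"
  proof (rule sum.mono_neutral_right)
    show "\<forall>i\<in>{j - int n..j} - {j + 1 - int n..j}. c i * cardinal_bspline n (\<tau> - of_int i) = 0"
    proof
      fix i assume "i \<in> {j - int n..j} - {j + 1 - int n..j}"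
      then have "i = j - int n" by auto
      then show "c i * cardinal_bspline n (\<tau> - of_int i) = 0" using z by simp
    qed
  qed auto
  also have "\<dots> = (\<Sum>k\<in>{j + 1 - int n..j + 1}. c k * cardinal_bspline n (\<tau> - of_int k))"
  proof (rule sum.mono_neutral_left)
    show "\<forall>i\<in>{j + 1 - int n..j + 1} - {j + 1 - int n..j}. c i * cardinal_bspline n (\<tau> - of_int i) = 0"
    proof
      fix i assume "i \<in> {j + 1 - int n..j + 1} - {j + 1 - int n..j}"
      then have "i = j + 1" by auto
      then show "c i * cardinal_bspline n (\<tau> - of_int i) = 0" using z by simp
    qed
  qed auto
  finally show ?thesis unfolding f .
next
  case False
  then have "\<lfloor>\<tau>\<rfloor> = j" using assms by linarith
  then show ?thesis by simp
qed

lemma marsden: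
  assumes "1 \<le> n" "of_int j \<le> \<tau>" "\<tau> \<le> of_int j + 1"
  shows "(\<Sum>k\<in>{j - int n..j}. (\<Prod>i=1..n. of_int k + real i - t) * cardinal_bspline n (\<tau> - of_int k)) = (\<tau> - t) ^ n"
  unfolding spline_sum_floor[OF assms] by (rule marsden_half_open) linarith+

lemma sum_cardinal_bspline:
  assumes "1 \<le> n" "of_int j \<le> \<tau>" "\<tau> \<le> of_int j + 1"
  shows "(\<Sum>k\<in>{j - int n..j}. cardinal_bspline n (\<tau> - of_int k)) = 1"
  using spline_sum_floor[OF assms, of "\<lambda>_. 1"] sum_cardinal_bspline_half_open[of "\<lfloor>\<tau>\<rfloor>" \<tau> n]
  by (simp only: mult_1) linarith

section \<open>Splines on one knot interval\<close>

text \<open>A bound for the norm of one-variable quasi-interpolation with respect to sup-norms.\<close>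

abbreviation weight_norm :: "nat \<Rightarrow> (nat \<Rightarrow> real) \<Rightarrow> real" where
  "weight_norm n w \<equiv> \<Sum>v\<le>n. \<bar>w v\<bar>"

text \<open>Off the knots the derivative is \<open>\<Sum>k. c k * (N (x - k) - N (x - k - 1))\<close> with B-splines \<open>N\<close> of
  the lower degree; both families are nonnegative and have sum \<open>1\<close>. The two points are kept in one
  knot interval because a spline of degree \<open>1\<close> is not differentiable at the knots.\<close>

lemma spline_lipschitz:
  assumes n: "1 \<le> n" and x: "of_int j \<le> x" "x \<le> of_int j + 1" and y: "of_int j \<le> y" "y \<le> of_int j + 1"
    and c: "\<And>k. k \<in> {j - int n..j} \<Longrightarrow> \<bar>c k\<bar> \<le> C"
  shows "\<bar>(\<Sum>k\<in>{j - int n..j}. c k * cardinal_bspline n (x - of_int k))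
         - (\<Sum>k\<in>{j - int n..j}. c k * cardinal_bspline n (y - of_int k))\<bar> \<le> 2 * C * \<bar>x - y\<bar>"
proof -
  define s where "s = (\<lambda>z. \<Sum>k\<in>{j - int n..j}. c k * cardinal_bspline n (z - of_int k))"
  have "j \<in> {j - int n..j}" by simp
  from c[OF this] have C0: "0 \<le> C" by linarith
  obtain m where m: "n = Suc m" using n by (cases n) auto
  let ?N = "cardinal_bspline m"
  have cont: "continuous_on A s" for A
  proof -
    have "continuous_on A (\<lambda>z. cardinal_bspline n (z - of_int k))" for k
      by (rule continuous_on_compose2[OF continuous_on_cardinal_bspline[OF n]]) (auto intro!: continuous_intros)
    then show ?thesis unfolding s_def by (intro continuous_intros)
  qed
  have deriv: "(s has_real_derivative (\<Sum>k\<in>{j - int n..j}. c k * (?N (z - of_int k) - ?N (z - of_int k - 1)))) (at z)"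
    if z: "of_int j < z" "z < of_int j + 1" for z
  proof -
    have "z - of_int k \<notin> \<int>" for k
    proof
      assume "z - of_int k \<in> \<int>"
      then have "z - of_int k + of_int k \<in> \<int>" by (intro Ints_add) auto
      then obtain i where "z = of_int i" by (auto elim!: Ints_cases)
      then have "of_int j < (of_int i :: real)" "of_int i < (of_int (j + 1) :: real)" using z by auto
      then show False by (simp only: of_int_less_iff)
    qed
    note d = DERIV_cardinal_bspline[OF this, where n = m, folded m]
    have sh: "((\<lambda>z. z - of_int k) has_real_derivative 1) (at z)" for k
      by (auto intro!: derivative_eq_intros)
    have "((\<lambda>z. cardinal_bspline n (z - of_int k)) has_real_derivative
        ?N (z - of_int k) - ?N (z - of_int k - 1)) (at z)" for k
      using DERIV_chain2[where f = "cardinal_bspline n" and g = "\<lambda>z. z - of_int k", OF d sh]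
      by (simp only: mult_1_right)
    then show ?thesis unfolding s_def by (intro DERIV_sum DERIV_cmult)
  qed
  have bound: "\<bar>\<Sum>k\<in>{j - int n..j}. c k * (?N (z - of_int k) - ?N (z - of_int k - 1))\<bar> \<le> 2 * C"
    if z: "of_int j < z" "z < of_int j + 1" for z
  proof -
    have nn: "0 \<le> ?N t" for t by (rule cardinal_bspline_nonneg)
    have one: "(\<Sum>k\<in>{j - int m..j}. ?N (z - of_int k)) = 1"
      using sum_cardinal_bspline_half_open[of j z m] z by simp
    have zero: "?N (z - of_int i) = 0" if "i < j - int m \<or> j < i" for i
    proof -
      have "of_int i \<le> (of_int j - real m - 1 :: real) \<or> of_int j + 1 \<le> (of_int i :: real)"
        using that by linarith
      then show ?thesis using z by (intro cardinal_bspline_support) linarith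
    qed
    have s1: "(\<Sum>k\<in>{j - int n..j}. ?N (z - of_int k)) = 1"
      unfolding one[symmetric] by (rule sum.mono_neutral_right) (auto intro!: zero simp: m)
    have "(\<Sum>k\<in>{j - int n..j}. ?N (z - of_int k - 1)) = (\<Sum>k\<in>{j - int m..j + 1}. ?N (z - of_int k))"
      by (rule sum.reindex_bij_witness[of _ "\<lambda>k. k - 1" "\<lambda>k. k + 1"]) (auto simp: m algebra_simps)
    also have "\<dots> = 1"
      unfolding one[symmetric] by (rule sum.mono_neutral_right) (auto intro!: zero)
    finally have s2: "(\<Sum>k\<in>{j - int n..j}. ?N (z - of_int k - 1)) = 1" .
    have "\<bar>\<Sum>k\<in>{j - int n..j}. c k * (?N (z - of_int k) - ?N (z - of_int k - 1))\<bar>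
      \<le> (\<Sum>k\<in>{j - int n..j}. \<bar>c k * (?N (z - of_int k) - ?N (z - of_int k - 1))\<bar>)"
      by (rule sum_abs)
    also have "\<dots> \<le> (\<Sum>k\<in>{j - int n..j}. C * (?N (z - of_int k) + ?N (z - of_int k - 1)))"
      unfolding abs_mult
      by (intro sum_mono mult_mono c) (use nn C0 in \<open>auto simp: abs_le_iff intro: add_increasing add_increasing2\<close>)
    also have "\<dots> = 2 * C"
      unfolding sum_distrib_left[symmetric] sum.distrib s1 s2 by simp
    finally show ?thesis .
  qed
  have main: "\<bar>s v - s u\<bar> \<le> 2 * C * (v - u)"
    if "u < v" "of_int j \<le> u" "v \<le> of_int j + 1" for u v
  proof -
    have "\<exists>l z. u < z \<and> z < v \<and> DERIV s z :> l \<and> s v - s u = (v - u) * l"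
      using that by (intro MVT cont) (auto simp: real_differentiable_def intro!: exI deriv)
    then obtain l z where z: "u < z" "z < v" "DERIV s z :> l" "s v - s u = (v - u) * l" by blast
    have zj: "of_int j < z" "z < of_int j + 1" using z that by auto
    have "l = (\<Sum>k\<in>{j - int n..j}. c k * (?N (z - of_int k) - ?N (z - of_int k - 1)))"
      using DERIV_unique[OF z(3) deriv[OF zj]] .
    then have "\<bar>l\<bar> \<le> 2 * C" using bound[OF zj] by simp
    then show ?thesis using z(4) that(1) by (simp add: abs_mult mult.commute mult_left_mono)
  qed
  consider "x < y" | "x = y" | "y < x" by linarith
  then have "\<bar>s x - s y\<bar> \<le> 2 * C * \<bar>x - y\<bar>"
    by cases (use main[of x y] main[of y x] x y in \<open>auto simp: abs_minus_commute\<close>)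
  then show ?thesis unfolding s_def .
qed

section \<open>Polynomial reproduction\<close>

text \<open>The hypothesis is an identity between polynomials in \<open>t\<close>; moving \<open>t\<close> by \<open>- u\<close> and
  comparing the coefficients of \<open>u\<^bsup>n - m\<^esup>\<close> yields the identity for exponent \<open>m\<close>.\<close>

lemma lower_moments:
  fixes c y :: "'a \<Rightarrow> real"
  assumes "\<And>t. (\<Sum>s\<in>A. c s * (y s - t) ^ n) = (x - t) ^ n" and "m \<le> n"
  shows "(\<Sum>s\<in>A. c s * (y s - t) ^ m) = (x - t) ^ m"
proof -
  let ?d = "\<lambda>k. real (n choose k) * (\<Sum>s\<in>A. c s * (y s - t) ^ (n - k))"
  have "(\<Sum>k\<le>n. ?d k * u ^ k) = (\<Sum>k\<le>n. (real (n choose k) * (x - t) ^ (n - k)) * u ^ k)" for u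
  proof -
    have "(\<Sum>k\<le>n. ?d k * u ^ k) =
        (\<Sum>k\<le>n. \<Sum>s\<in>A. c s * (real (n choose k) * u ^ k * (y s - t) ^ (n - k)))"
      unfolding sum_distrib_left sum_distrib_right by (intro sum.cong refl) (simp add: mult_ac)
    also have "\<dots> = (\<Sum>s\<in>A. c s * (u + (y s - t)) ^ n)"
      by (subst sum.swap) (simp add: binomial_ring sum_distrib_left)
    also have "\<dots> = (u + (x - t)) ^ n"
      using assms(1)[of "t - u"] by (simp add: algebra_simps)
    also have "\<dots> = (\<Sum>k\<le>n. (real (n choose k) * (x - t) ^ (n - k)) * u ^ k)"
      by (simp add: binomial_ring mult_ac)
    finally show ?thesis .
  qed
  then have "\<forall>k\<le>n. ?d k = real (n choose k) * (x - t) ^ (n - k)"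
    by (subst polyfun_eq_coeffs[symmetric]) simp
  from this[rule_format, of "n - m"] show ?thesis
    using assms(2) by (auto simp: binomial_eq_0_iff)
qed

text \<open>Both sides are polynomials in \<open>t\<close> of degree at most \<open>n\<close>, and the equations that define the
  weights say that they agree at the \<open>n + 1\<close> points \<open>t = k + j + 1/2\<close>. The right-hand side is the
  coefficient of the B-spline with index \<open>k\<close> in Marsden's identity.\<close>

lemma quasi_weights_dual:
  assumes "quasi_weights n w"
  shows "(\<Sum>v\<le>n. w v * (of_int k + real v + 1/2 - t) ^ n) = (\<Prod>i=1..n. of_int k + real i - t)"
proof -
  let ?l = "\<Sum>v=0..n. smult (w v) ([:real v, -1:] ^ n)" and ?r = "\<Prod>i=1..n. [:real i - 1/2, -1:]"
  have "?l = ?r"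
  proof (rule poly_eqI_degree[of "real ` {0..n}"])
    show "poly ?l x = poly ?r x" if "x \<in> real ` {0..n}" for x
      using that assms by (auto simp: quasi_weights_def poly_sum poly_prod algebra_simps)
    have "card (real ` {0..n}) = n + 1" by (subst card_image) auto
    moreover have "degree ?l \<le> n"
    proof (rule degree_sum_le)
      fix v
      have "degree ([:real v, -1:] ^ n) \<le> n" using degree_power_le[of "[:real v, -1:]" n] by simp
      then show "degree (smult (w v) ([:real v, -1:] ^ n)) \<le> n" by (metis degree_smult_le le_trans)
    qed simp
    moreover have "degree ?r \<le> n"
      using degree_prod_sum_le[of "{1..n}" "\<lambda>i. [:real i - 1/2, -1:]"] by simp
    ultimately show "card (real ` {0..n}) > degree ?l" "card (real ` {0..n}) > degree ?r" by auto
  qed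
  then have "poly ?l (t - of_int k - 1/2) = poly ?r (t - of_int k - 1/2)" by simp
  then show ?thesis by (simp add: poly_sum poly_prod algebra_simps atLeast0AtMost)
qed

text \<open>One-variable quasi-interpolation over the integers, in the form that it takes on the knot
  interval from \<open>j\<close> to \<open>j + 1\<close>.\<close>

definition local_quasi ::
    "nat \<Rightarrow> (nat \<Rightarrow> real) \<Rightarrow> int \<Rightarrow> (real \<Rightarrow> real) \<Rightarrow> real \<Rightarrow> real" where
  "local_quasi n w j g x =
     (\<Sum>k\<in>{j - int n..j}. (\<Sum>v\<le>n. w v * g (of_int k + real v + 1/2)) * cardinal_bspline n (x - of_int k))"

lemma local_quasi_diff:
  "local_quasi n w j (\<lambda>y. f y - g y) x = local_quasi n w j f x - local_quasi n w j g x"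
  by (simp add: local_quasi_def right_diff_distrib left_diff_distrib sum_subtractf)

lemma local_quasi_linear_comb:
  "local_quasi n w j (\<lambda>y. \<Sum>m\<in>A. a m * g m y) x = (\<Sum>m\<in>A. a m * local_quasi n w j (g m) x)"
proof -
  have "local_quasi n w j (\<lambda>y. \<Sum>m\<in>A. a m * g m y) x =
     (\<Sum>k\<in>{j - int n..j}. \<Sum>v\<le>n. \<Sum>m\<in>A. a m * (w v * g m (of_int k + real v + 1/2) * cardinal_bspline n (x - of_int k)))"
    unfolding local_quasi_def sum_distrib_right sum_distrib_left
    by (intro sum.cong refl) (simp add: mult_ac)
  also have "\<dots> = (\<Sum>k\<in>{j - int n..j}. \<Sum>m\<in>A. \<Sum>v\<le>n. a m * (w v * g m (of_int k + real v + 1/2) * cardinal_bspline n (x - of_int k)))"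
    by (intro sum.cong refl sum.swap)
  also have "\<dots> = (\<Sum>m\<in>A. \<Sum>k\<in>{j - int n..j}. \<Sum>v\<le>n. a m * (w v * g m (of_int k + real v + 1/2) * cardinal_bspline n (x - of_int k)))"
    by (rule sum.swap)
  finally show ?thesis
    unfolding local_quasi_def sum_distrib_right sum_distrib_left .
qed

lemma local_quasi_power:
  assumes n: "1 \<le> n" and w: "quasi_weights n w" and x: "of_int j \<le> x" "x \<le> of_int j + 1"
    and m: "m \<le> n"
  shows "local_quasi n w j (\<lambda>y. (y - t) ^ m) x = (x - t) ^ m"
proof -
  let ?A = "{j - int n..j} \<times> {..n}"
  let ?c = "\<lambda>(k, v). w v * cardinal_bspline n (x - of_int k)"
  let ?y = "\<lambda>(k :: int, v). of_int k + real v + 1/2"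
  have eq: "local_quasi n w j (\<lambda>y. (y - t) ^ m) x = (\<Sum>s\<in>?A. ?c s * (?y s - t) ^ m)" for m t
    unfolding local_quasi_def sum.cartesian_product[symmetric] sum_distrib_right
    by (simp add: sum.cartesian_product mult_ac case_prod_unfold)
  have "(\<Sum>s\<in>?A. ?c s * (?y s - t) ^ n) = (x - t) ^ n" for t
    unfolding eq[symmetric] local_quasi_def quasi_weights_dual[OF w] by (rule marsden[OF n x])
  then show ?thesis unfolding eq by (rule lower_moments) (rule m)
qed

lemma local_coefficient_bound:
  fixes w :: "nat \<Rightarrow> real"
  assumes "\<And>y. of_int j - real n \<le> y \<Longrightarrow> y \<le> of_int j + real n + 1 \<Longrightarrow> \<bar>g y\<bar> \<le> B"
    and "k \<in> {j - int n..j}"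
  shows "\<bar>\<Sum>v\<le>n. w v * g (of_int k + real v + 1/2)\<bar> \<le> weight_norm n w * B"
proof -
  have "\<bar>\<Sum>v\<le>n. w v * g (of_int k + real v + 1/2)\<bar> \<le> (\<Sum>v\<le>n. \<bar>w v * g (of_int k + real v + 1/2)\<bar>)"
    by (rule sum_abs)
  also have "\<dots> \<le> (\<Sum>v\<le>n. \<bar>w v\<bar> * B)"
  proof (rule sum_mono)
    fix v assume "v \<in> {..n}"
    then have "real v \<le> real n" by simp
    moreover have "of_int j - real n \<le> of_int k" "of_int k \<le> (of_int j :: real)" using assms(2) by auto
    ultimately show "\<bar>w v * g (of_int k + real v + 1/2)\<bar> \<le> \<bar>w v\<bar> * B"
      unfolding abs_mult by (intro mult_left_mono assms(1)) auto
  qed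
  finally show ?thesis by (simp add: sum_distrib_right)
qed

lemma local_quasi_bound:
  assumes "1 \<le> n" and x: "of_int j \<le> x" "x \<le> of_int j + 1"
    and g: "\<And>y. of_int j - real n \<le> y \<Longrightarrow> y \<le> of_int j + real n + 1 \<Longrightarrow> \<bar>g y\<bar> \<le> B"
  shows "\<bar>local_quasi n w j g x\<bar> \<le> weight_norm n w * B"
proof -
  have "\<bar>local_quasi n w j g x\<bar> \<le>
      (\<Sum>k\<in>{j - int n..j}. \<bar>(\<Sum>v\<le>n. w v * g (of_int k + real v + 1/2)) * cardinal_bspline n (x - of_int k)\<bar>)"
    unfolding local_quasi_def by (rule sum_abs)
  also have "\<dots> \<le> (\<Sum>k\<in>{j - int n..j}. weight_norm n w * B * cardinal_bspline n (x - of_int k))"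
    unfolding abs_mult
    by (intro sum_mono mult_mono local_coefficient_bound g)
       (use cardinal_bspline_nonneg in \<open>auto intro!: order_trans[OF abs_ge_zero local_coefficient_bound] g\<close>)
  also have "\<dots> = weight_norm n w * B"
    unfolding sum_distrib_left[symmetric] sum_cardinal_bspline[OF assms(1) x] by simp
  finally show ?thesis .
qed

lemma local_quasi_lipschitz:
  assumes "1 \<le> n" and x: "of_int j \<le> x" "x \<le> of_int j + 1" and y: "of_int j \<le> y" "y \<le> of_int j + 1"
    and g: "\<And>y. of_int j - real n \<le> y \<Longrightarrow> y \<le> of_int j + real n + 1 \<Longrightarrow> \<bar>g y\<bar> \<le> B"
  shows "\<bar>local_quasi n w j g x - local_quasi n w j g y\<bar> \<le> 2 * (weight_norm n w * B) * \<bar>x - y\<bar>"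
  unfolding local_quasi_def
  by (rule spline_lipschitz[OF assms(1) x y]) (rule local_coefficient_bound[OF g])

text \<open>The constant function \<open>1\<close> is reproduced, and the norm bounds its image.\<close>

lemma sum_abs_weights_ge_1:
  assumes "1 \<le> n" and "quasi_weights n w"
  shows "1 \<le> weight_norm n w"
  using local_quasi_power[OF assms, of 0 0 0 0] local_quasi_bound[OF assms(1), of 0 0 "\<lambda>_. 1" 1 w]
  by simp

section \<open>Taylor polynomials\<close>

text \<open>The function is given together with its derivatives: \<open>diff m\<close> is the derivative of order
  \<open>m\<close> of \<open>diff 0\<close>.\<close>

definition taylor_poly :: "nat \<Rightarrow> (nat \<Rightarrow> real \<Rightarrow> real) \<Rightarrow> real \<Rightarrow> real \<Rightarrow> real" where
  "taylor_poly n diff c y = (\<Sum>m\<le>n. diff m c / fact m * (y - c) ^ m)"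

lemma taylor_poly_error:
  assumes D: "\<And>m t. m \<le> n \<Longrightarrow> a \<le> t \<Longrightarrow> t \<le> b \<Longrightarrow> (diff m has_real_derivative diff (Suc m) t) (at t)"
    and M: "\<And>t. a \<le> t \<Longrightarrow> t \<le> b \<Longrightarrow> \<bar>diff (Suc n) t\<bar> \<le> M"
    and c: "a \<le> c" "c \<le> b" and y: "a \<le> y" "y \<le> b" "\<bar>y - c\<bar> \<le> r"
  shows "\<bar>diff 0 y - taylor_poly n diff c y\<bar> \<le> M * r ^ Suc n / fact (Suc n)"
proof (cases "y = c")
  case True
  have "0 \<le> M" using M[OF c] by linarith
  moreover have "taylor_poly n diff c c = diff 0 c"
    unfolding taylor_poly_def by (subst sum.remove[of _ 0]) auto
  ultimately show ?thesis using True y(3) by simp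
next
  case False
  have "\<exists>t. (if y < c then y < t \<and> t < c else c < t \<and> t < y) \<and>
    diff 0 y = (\<Sum>m<Suc n. (diff m c / fact m) * (y - c)^m) + (diff (Suc n) t / fact (Suc n)) * (y - c)^Suc n"
    by (rule Taylor[of "Suc n" diff "diff 0" a b c y]) (use D c y False in auto)
  then obtain t where t: "if y < c then y < t \<and> t < c else c < t \<and> t < y"
    "diff 0 y = taylor_poly n diff c y + (diff (Suc n) t / fact (Suc n)) * (y - c)^Suc n"
    unfolding taylor_poly_def lessThan_Suc_atMost by blast
  have "\<bar>diff 0 y - taylor_poly n diff c y\<bar> = \<bar>diff (Suc n) t\<bar> * \<bar>y - c\<bar> ^ Suc n / fact (Suc n)"
    unfolding t(2) by (simp add: abs_mult power_abs del: fact_Suc power_Suc)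
  also have "\<dots> \<le> M * r ^ Suc n / fact (Suc n)"
  proof -
    have tt: "a \<le> t" "t \<le> b" using t(1) c y by (auto split: if_splits)
    have "\<bar>y - c\<bar> ^ Suc n \<le> r ^ Suc n" using y(3) by (intro power_mono) auto
    moreover have "0 \<le> M" using M[OF c] by linarith
    ultimately show ?thesis
      by (intro divide_right_mono mult_mono M tt) (auto simp del: power_Suc)
  qed
  finally show ?thesis .
qed

lemma DERIV_taylor_poly:
  assumes "1 \<le> n"
  shows "(taylor_poly n diff c has_real_derivative taylor_poly (n - 1) (\<lambda>m. diff (Suc m)) c y) (at y)"
proof -
  obtain k where k: "n = Suc k" using assms by (cases n) auto
  have "((\<lambda>y. \<Sum>m\<le>n. diff m c / fact m * (y - c) ^ m) has_real_derivative
      (\<Sum>m\<le>n. diff m c / fact m * (real m * (y - c) ^ (m - 1)))) (at y)"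
    by (intro DERIV_sum DERIV_cmult) (auto intro!: derivative_eq_intros)
  moreover have "(\<Sum>m\<le>n. diff m c / fact m * (real m * (y - c) ^ (m - 1))) =
      taylor_poly (n - 1) (\<lambda>m. diff (Suc m)) c y"
    unfolding k sum.atMost_Suc_shift taylor_poly_def
    by (simp add: field_simps del: of_nat_Suc)
  ultimately show ?thesis by (simp add: taylor_poly_def[abs_def])
qed

lemma local_quasi_taylor_poly:
  assumes "1 \<le> n" "quasi_weights n w" "of_int j \<le> x" "x \<le> of_int j + 1"
  shows "local_quasi n w j (taylor_poly n diff c) x = taylor_poly n diff c x"
  unfolding taylor_poly_def[abs_def] local_quasi_linear_comb
  by (intro sum.cong refl arg_cong2[where f = "(*)"] local_quasi_power assms) auto

section \<open>The error on one knot interval\<close>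

context
  fixes n :: nat and w :: "nat \<Rightarrow> real" and j :: int and diff :: "nat \<Rightarrow> real \<Rightarrow> real" and M :: real
  assumes n: "1 \<le> n" and w: "quasi_weights n w"
    and D: "\<And>m t. m \<le> n \<Longrightarrow> of_int j - real n \<le> t \<Longrightarrow> t \<le> of_int j + real n + 1 \<Longrightarrow>
        (diff m has_real_derivative diff (Suc m) t) (at t)"
    and M: "\<And>t. of_int j - real n \<le> t \<Longrightarrow> t \<le> of_int j + real n + 1 \<Longrightarrow> \<bar>diff (Suc n) t\<bar> \<le> M"
begin

lemma midpoint_taylor_error:
  assumes "of_int j - real n \<le> y" "y \<le> of_int j + real n + 1"
  shows "\<bar>diff 0 y - taylor_poly n diff (of_int j + 1/2) y\<bar> \<le> M * (real n + 1/2) ^ Suc n / fact (Suc n)"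
proof (rule taylor_poly_error[where a = "of_int j - real n" and b = "of_int j + real n + 1"])
  show "\<bar>y - (of_int j + 1/2)\<bar> \<le> real n + 1/2" using assms by linarith
qed (use assms D M in auto)

text \<open>The Taylor polynomial at the midpoint is reproduced, so the error of the function equals
  the error of the Taylor remainder, which is small at all points that are sampled.\<close>

lemma local_quasi_error:
  assumes x: "of_int j \<le> x" "x \<le> of_int j + 1"
  shows "\<bar>diff 0 x - local_quasi n w j (diff 0) x\<bar>
     \<le> (1 + weight_norm n w) * (M * (real n + 1/2) ^ Suc n / fact (Suc n))"
proof -
  let ?T = "taylor_poly n diff (of_int j + 1/2)"
  let ?g = "\<lambda>y. diff 0 y - ?T y"
  have "diff 0 x - local_quasi n w j (diff 0) x = ?g x - local_quasi n w j ?g x"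
    by (simp add: local_quasi_diff local_quasi_taylor_poly[OF n w x])
  moreover have "\<bar>?g x\<bar> \<le> M * (real n + 1/2) ^ Suc n / fact (Suc n)"
    by (rule midpoint_taylor_error) (use x in auto)
  moreover have "\<bar>local_quasi n w j ?g x\<bar> \<le> weight_norm n w * (M * (real n + 1/2) ^ Suc n / fact (Suc n))"
    by (rule local_quasi_bound[OF n x]) (rule midpoint_taylor_error)
  ultimately show ?thesis unfolding distrib_right mult_1 by linarith
qed

text \<open>As for the error itself, only the Taylor remainder counts. Its derivative is the Taylor
  remainder of the derivative, with one power of the radius less; its quasi-interpolant is a spline
  with small coefficients.\<close>

lemma local_quasi_error_lipschitz:
  assumes x: "of_int j \<le> x" "x \<le> of_int j + 1" and y: "of_int j \<le> y" "y \<le> of_int j + 1"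
  shows "\<bar>(diff 0 x - local_quasi n w j (diff 0) x) - (diff 0 y - local_quasi n w j (diff 0) y)\<bar>
     \<le> (M * (real n + 1/2) ^ n / fact n
        + 2 * (weight_norm n w * (M * (real n + 1/2) ^ Suc n / fact (Suc n)))) * \<bar>x - y\<bar>"
proof -
  let ?c = "of_int j + 1/2 :: real"
  let ?T = "taylor_poly n diff ?c" and ?T' = "taylor_poly (n - 1) (\<lambda>m. diff (Suc m)) ?c"
  let ?g = "\<lambda>y. diff 0 y - ?T y"
  let ?I = "{of_int j..of_int j + 1 :: real}"
  have eq: "diff 0 z - local_quasi n w j (diff 0) z = ?g z - local_quasi n w j ?g z"
    if "of_int j \<le> z" "z \<le> of_int j + 1" for z
    by (simp add: local_quasi_diff local_quasi_taylor_poly[OF n w that])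
  have dg: "(?g has_real_derivative diff (Suc 0) z - ?T' z) (at z within ?I)" if "z \<in> ?I" for z
    by (intro has_field_derivative_at_within[where s = ?I] DERIV_diff D DERIV_taylor_poly n)
       (use that in auto)
  have Suc: "Suc (n - 1) = n" using n by simp
  have "norm (diff (Suc 0) z - ?T' z) \<le> M * (real n + 1/2) ^ n / fact n" if "z \<in> ?I" for z
    using taylor_poly_error[of "n - 1" "of_int j - real n" "of_int j + real n + 1" "\<lambda>m. diff (Suc m)" M ?c z "real n + 1/2"]
      that D M n unfolding Suc by (auto simp: abs_le_iff)
  from field_differentiable_bound[OF _ dg this, of x y]
  have "\<bar>?g x - ?g y\<bar> \<le> M * (real n + 1/2) ^ n / fact n * \<bar>x - y\<bar>"
    using x y by (auto simp: abs_minus_commute)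
  moreover have "\<bar>local_quasi n w j ?g x - local_quasi n w j ?g y\<bar>
      \<le> 2 * (weight_norm n w * (M * (real n + 1/2) ^ Suc n / fact (Suc n))) * \<bar>x - y\<bar>"
    by (rule local_quasi_lipschitz[OF n x y]) (rule midpoint_taylor_error)
  ultimately show ?thesis unfolding eq[OF x] eq[OF y] distrib_right by linarith
qed

end

section \<open>One axis with uniform knots\<close>

lemma uniform_knots_convex:
  "uniform_knots h K \<xi> \<Longrightarrow> i \<in> K \<Longrightarrow> k \<in> K \<Longrightarrow> i \<le> m \<Longrightarrow> m \<le> k \<Longrightarrow> m \<in> K"
  by (auto simp: uniform_knots_def)

lemma uniform_knots_affine:
  assumes "uniform_knots h K \<xi>"
  obtains c where "\<forall>k\<in>K. \<xi> k = c + of_int k * h"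
proof -
  have "K \<noteq> {}" using assms by (auto simp: uniform_knots_def)
  then obtain k0 where k0: "k0 \<in> K" by blast
  have "\<xi> k = \<xi> k0 - of_int k0 * h + of_int k * h" if k: "k \<in> K" for k
  proof -
    let ?a = "min k0 k" and ?b = "max k0 k"
    have step: "\<xi> (i + 1) = \<xi> i + h" if "?a \<le> i" "i < ?b" for i
    proof -
      have "?a \<in> K" "?b \<in> K" using k k0 by (auto simp: min_def max_def)
      then have "i \<in> K" "i + 1 \<in> K" using that uniform_knots_convex[OF assms, of ?a ?b] by auto
      then show ?thesis using assms by (auto simp: uniform_knots_def)
    qed
    have "\<xi> k = \<xi> ?a + of_int (k - ?a) * h" "\<xi> k0 = \<xi> ?a + of_int (k0 - ?a) * h"
      using uniform_knots_diff[of ?a ?b \<xi> h k, OF step] uniform_knots_diff[of ?a ?b \<xi> h k0, OF step] by auto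
    then show ?thesis by (simp add: algebra_simps)
  qed
  then show ?thesis by (intro that ballI)
qed

lemma parameter_interval_subset_knot_hull:
  assumes K: "uniform_knots h K \<xi>"
  shows "parameter_interval n K \<xi> \<subseteq> knot_hull K \<xi>"
proof
  fix z assume "z \<in> parameter_interval n K \<xi>"
  then obtain j where j: "j - int n \<in> K" "j + 1 + int n \<in> K" "z \<in> {\<xi> j..\<xi> (j + 1)}"
    unfolding parameter_interval_def by blast
  moreover have "j \<in> K" "j + 1 \<in> K" using uniform_knots_convex[OF K j(1,2)] by auto
  ultimately show "z \<in> knot_hull K \<xi>" unfolding knot_hull_def by blast
qed

definition active_indices :: "nat \<Rightarrow> int set \<Rightarrow> (int \<Rightarrow> real) \<Rightarrow> real \<Rightarrow> int set" where
  "active_indices n K \<xi> z = {k \<in> bspline_indices n K. bspline \<xi> n k z \<noteq> 0}"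

text \<open>Restricting the sum to the B-splines that do not vanish at \<open>z\<close> makes it finite also for a
  bi-infinite knot sequence.\<close>

definition axis_quasi ::
    "real \<Rightarrow> nat \<Rightarrow> (nat \<Rightarrow> real) \<Rightarrow> int set \<Rightarrow> (int \<Rightarrow> real) \<Rightarrow> (real \<Rightarrow> real) \<Rightarrow> real \<Rightarrow> real" where
  "axis_quasi h n w K \<xi> g z =
     (\<Sum>(k, v)\<in>active_indices n K \<xi> z \<times> {..n}. bspline \<xi> n k z * w v * g (\<xi> (k + int v) + h / 2))"

context
  fixes h :: real and n :: nat and w :: "nat \<Rightarrow> real" and K :: "int set" and \<xi> :: "int \<Rightarrow> real"
  assumes n: "1 \<le> n" and h: "0 < h" and K: "uniform_knots h K \<xi>"
begin

text \<open>The centre of the Taylor expansion changes with the knot interval, so slopes can be estimated on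
  one knot interval at a time only. Closed knot intervals that cover a segment pass their common
  Lipschitz constant on to it.\<close>

lemma parameter_interval_cells:
  assumes cell: "\<And>j x y. j - int n \<in> K \<Longrightarrow> j + 1 + int n \<in> K \<Longrightarrow> x \<in> {\<xi> j..\<xi> (j + 1)} \<Longrightarrow>
      y \<in> {\<xi> j..\<xi> (j + 1)} \<Longrightarrow> \<bar>\<phi> x - \<phi> y\<bar> \<le> L * \<bar>x - y\<bar>"
    and x: "x \<in> parameter_interval n K \<xi>" and y: "y \<in> parameter_interval n K \<xi>" and L: "0 \<le> L"
  shows "\<bar>\<phi> x - \<phi> y\<bar> \<le> L * \<bar>x - y\<bar>"
proof -
  obtain c where c: "\<forall>k\<in>K. \<xi> k = c + of_int k * h" using uniform_knots_affine[OF K] by blast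
  have main: "\<bar>\<phi> v - \<phi> u\<bar> \<le> L * \<bar>v - u\<bar>"
    if u: "u \<in> parameter_interval n K \<xi>" and v: "v \<in> parameter_interval n K \<xi>" and uv: "u < v" for u v
  proof -
    from u v obtain i k where i: "i - int n \<in> K" "i + 1 + int n \<in> K" "u \<in> {\<xi> i..\<xi> (i + 1)}"
      and k: "k - int n \<in> K" "k + 1 + int n \<in> K" "v \<in> {\<xi> k..\<xi> (k + 1)}"
      unfolding parameter_interval_def by blast
    have iK: "i \<in> K" "k + 1 \<in> K"
      using uniform_knots_convex[OF K i(1,2)] uniform_knots_convex[OF K k(1,2)] by auto
    have in_cell: "\<exists>j\<in>{i..k}. z \<in> {\<xi> j..\<xi> (j + 1)}" if z: "z \<in> {u..v}" for z
    proof -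
      let ?t = "(z - c) / h"
      have "\<xi> i \<le> z" "z \<le> \<xi> (k + 1)" using z i k by auto
      then have t: "of_int i \<le> ?t" "?t \<le> of_int (k + 1)"
        using h c iK by (auto simp: field_simps)
      have t': "of_int i < ?t \<or> ?t < of_int (k + 1)"
        using uv z i k h c iK by (auto simp: field_simps)
      \<comment> \<open>The right end of the last knot interval belongs to that interval.\<close>
      define j where "j = (if ?t = of_int (k + 1) then k else \<lfloor>?t\<rfloor>)"
      have j: "i \<le> j" "j \<le> k" "of_int j \<le> ?t" "?t \<le> of_int j + 1"
        using t t' unfolding j_def by (auto simp: le_floor_iff floor_le_iff)
      have "j \<in> K" "j + 1 \<in> K" using j iK uniform_knots_convex[OF K iK] by auto
      then have "z \<in> {\<xi> j..\<xi> (j + 1)}" using j(3,4) h c by (auto simp: field_simps)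
      then show ?thesis using j by auto
    qed
    have "lipschitz_on L {u..v} \<phi>"
    proof (rule lipschitz_on_closed_Union[where I = "{i..k}" and U = "\<lambda>j. {\<xi> j..\<xi> (j + 1)}"])
      fix j assume j: "j \<in> {i..k}"
      have "j - int n \<in> K" "j + 1 + int n \<in> K"
        using uniform_knots_convex[OF K i(1) k(2)] j by auto
      from cell[OF this] show "lipschitz_on L {\<xi> j..\<xi> (j + 1)} \<phi>"
        by (intro lipschitz_onI L) (auto simp: dist_real_def)
    qed (use in_cell L in auto)
    from lipschitz_onD[OF this, of v u] show ?thesis using uv by (simp add: dist_real_def)
  qed
  consider "x < y" | "x = y" | "y < x" by linarith
  then show ?thesis
    by cases (use main[OF x y] main[OF y x] in \<open>auto simp: abs_minus_commute\<close>)
qed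

context
  fixes c :: real
  assumes c: "\<forall>k\<in>K. \<xi> k = c + of_int k * h"
begin

lemma bspline_eq_cardinal_bspline:
  "k \<in> bspline_indices m K \<Longrightarrow> bspline \<xi> m k z = cardinal_bspline m ((z - c) / h - of_int k)"
proof (induction m arbitrary: k)
  case 0
  then have "\<xi> k = c + of_int k * h" "\<xi> (k + 1) = c + (of_int k + 1) * h"
    using c by (auto simp: bspline_indices_def)
  then show ?case using h by (auto simp: field_simps)
next
  case (Suc m)
  have mem: "k \<in> K" "k + 1 \<in> K" "k + int m + 1 \<in> K" "k + int m + 2 \<in> K"
    using Suc.prems uniform_knots_convex[OF K, of k "k + int m + 2"]
    by (auto simp: bspline_indices_def algebra_simps)
  then have "k \<in> bspline_indices m K" "k + 1 \<in> bspline_indices m K"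
    by (auto simp: bspline_indices_def algebra_simps)
  note IH = this[THEN Suc.IH]
  let ?t = "(z - c) / h - of_int k"
  have e: "k + int (Suc m) = k + int m + 1" "k + 1 + int (Suc m) = k + int m + 2" by auto
  obtain t where t: "t = ?t" by blast
  then have z: "z = c + (t + of_int k) * h" using h by simp
  have "z - \<xi> k = h * t" "\<xi> (k + int m + 1) - \<xi> k = h * (real m + 1)"
    "z - \<xi> (k + 1) = h * (t - 1)" "\<xi> (k + int m + 2) - \<xi> (k + 1) = h * (real m + 1)"
    using c mem by (simp_all add: z algebra_simps)
  then have r: "knot_ratio \<xi> (Suc m) k z = ?t / (real m + 1)"
    and r': "1 - knot_ratio \<xi> (Suc m) (k + 1) z = (real m + 2 - ?t) / (real m + 1)"
    using h unfolding knot_ratio_def e t[symmetric] by (simp_all add: divide_simps)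
  have t1: "(z - c) / h - of_int (k + 1) = ?t - 1" by simp
  show ?case unfolding bspline.simps cardinal_bspline.simps IH r r' t1 by (simp add: add_divide_distrib)
qed

lemma cell_coordinate:
  assumes j: "j - int n \<in> K" "j + 1 + int n \<in> K"
  shows "z \<in> {\<xi> j..\<xi> (j + 1)} \<longleftrightarrow> of_int j \<le> (z - c) / h \<and> (z - c) / h \<le> of_int j + 1"
proof -
  have "j \<in> K" "j + 1 \<in> K" using uniform_knots_convex[OF K j] by auto
  then show ?thesis using c h by (auto simp: field_simps)
qed

text \<open>All samples relevant on a knot interval of the parameter interval lie in the \<open>n\<close> neighbouring
  knot intervals on either side, which exist by the choice of the parameter interval.\<close>

lemma cell_neighbourhood:
  assumes j: "j - int n \<in> K" "j + 1 + int n \<in> K"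
    and y: "of_int j - real n \<le> y" "y \<le> of_int j + real n + 1"
  shows "c + y * h \<in> knot_hull K \<xi>"
proof -
  define m where "m = min (j + int n) \<lfloor>y\<rfloor>"
  have m: "j - int n \<le> m" "m \<le> j + int n" "of_int m \<le> y" "y \<le> of_int m + 1"
    using y unfolding m_def by (auto simp: le_floor_iff min_def) linarith+
  have mK: "m \<in> K" "m + 1 \<in> K" using m uniform_knots_convex[OF K j] by auto
  have "c + of_int m * h \<le> c + y * h" "c + y * h \<le> c + (of_int m + 1) * h"
    using m h by (auto intro!: mult_right_mono)
  then have "c + y * h \<in> {\<xi> m..\<xi> (m + 1)}" using c mK by simp
  then show ?thesis using mK unfolding knot_hull_def by blast
qed

lemma active_indices_cell:
  assumes j: "j - int n \<in> K" "j + 1 + int n \<in> K" and z: "z \<in> {\<xi> j..\<xi> (j + 1)}"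
  shows "active_indices n K \<xi> z \<subseteq> {j - int n..j}" and "{j - int n..j} \<subseteq> bspline_indices n K"
proof -
  let ?t = "(z - c) / h"
  have t: "of_int j \<le> ?t" "?t \<le> of_int j + 1" using cell_coordinate[OF j] z by auto
  show "active_indices n K \<xi> z \<subseteq> {j - int n..j}"
  proof
    fix k assume "k \<in> active_indices n K \<xi> z"
    then have k: "cardinal_bspline n (?t - of_int k) \<noteq> 0"
      unfolding active_indices_def using bspline_eq_cardinal_bspline[of k n z] by auto
    then have "0 < ?t - of_int k" "?t - of_int k < real n + 1"
      using cardinal_bspline_support[of "?t - of_int k" n] cardinal_bspline_at_zero[OF n]
      by (metis not_less_iff_gr_or_eq, metis not_le)
    then show "k \<in> {j - int n..j}" using t by auto
  qed
  show "{j - int n..j} \<subseteq> bspline_indices n K"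
    using uniform_knots_convex[OF K j] by (auto simp: bspline_indices_def)
qed

text \<open>After the substitution \<open>z = c + y * h\<close> the operator is the one over the integers.\<close>

lemma axis_quasi_cell:
  assumes j: "j - int n \<in> K" "j + 1 + int n \<in> K" and z: "z \<in> {\<xi> j..\<xi> (j + 1)}"
  shows "axis_quasi h n w K \<xi> g z = local_quasi n w j (\<lambda>y. g (c + y * h)) ((z - c) / h)"
proof -
  note sub = active_indices_cell[OF j z]
  have "axis_quasi h n w K \<xi> g z =
      (\<Sum>k\<in>active_indices n K \<xi> z. bspline \<xi> n k z * (\<Sum>v\<le>n. w v * g (\<xi> (k + int v) + h / 2)))"
    unfolding axis_quasi_def sum.cartesian_product[symmetric] sum_distrib_left
    by (simp add: mult_ac)
  also have "\<dots> = (\<Sum>k\<in>{j - int n..j}. bspline \<xi> n k z * (\<Sum>v\<le>n. w v * g (\<xi> (k + int v) + h / 2)))"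
    using sub by (intro sum.mono_neutral_left) (auto simp: active_indices_def)
  also have "\<dots> = local_quasi n w j (\<lambda>y. g (c + y * h)) ((z - c) / h)"
    unfolding local_quasi_def
  proof (intro sum.cong refl, subst mult.commute, intro arg_cong2[where f = "(*)"] sum.cong refl)
    fix k assume k: "k \<in> {j - int n..j}"
    show "bspline \<xi> n k z = cardinal_bspline n ((z - c) / h - of_int k)"
      using k sub by (intro bspline_eq_cardinal_bspline) auto
    fix v assume "v \<in> {..n}"
    then have "k + int v \<in> K" using k uniform_knots_convex[OF K j] by auto
    then show "g (\<xi> (k + int v) + h / 2) = g (c + (of_int k + real v + 1 / 2) * h)"
      using c by (simp add: algebra_simps)
  qed
  finally show ?thesis .
qed

end

lemma finite_active_indices:
  assumes "z \<in> parameter_interval n K \<xi>"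
  shows "finite (active_indices n K \<xi> z)"
proof -
  obtain c where c: "\<forall>k\<in>K. \<xi> k = c + of_int k * h" using uniform_knots_affine[OF K] by blast
  from assms obtain j where j: "j - int n \<in> K" "j + 1 + int n \<in> K" "z \<in> {\<xi> j..\<xi> (j + 1)}"
    unfolding parameter_interval_def by blast
  show ?thesis using active_indices_cell(1)[OF c j] by (rule finite_subset) auto
qed

lemma axis_quasi_bound:
  assumes z: "z \<in> parameter_interval n K \<xi>" and g: "\<And>y. y \<in> knot_hull K \<xi> \<Longrightarrow> \<bar>g y\<bar> \<le> B"
  shows "\<bar>axis_quasi h n w K \<xi> g z\<bar> \<le> weight_norm n w * B"
proof -
  obtain c where c: "\<forall>k\<in>K. \<xi> k = c + of_int k * h" using uniform_knots_affine[OF K] by blast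
  from z obtain j where j: "j - int n \<in> K" "j + 1 + int n \<in> K" "z \<in> {\<xi> j..\<xi> (j + 1)}"
    unfolding parameter_interval_def by blast
  have "of_int j \<le> (z - c) / h" "(z - c) / h \<le> of_int j + 1"
    using cell_coordinate[OF c j(1,2)] j(3) by auto
  then show ?thesis unfolding axis_quasi_cell[OF c j]
    by (rule local_quasi_bound[OF n]) (intro g cell_neighbourhood[OF c j(1,2)])
qed

lemma axis_quasi_lipschitz:
  assumes x: "x \<in> parameter_interval n K \<xi>" and y: "y \<in> parameter_interval n K \<xi>"
    and g: "\<And>y. y \<in> knot_hull K \<xi> \<Longrightarrow> \<bar>g y\<bar> \<le> B"
  shows "\<bar>axis_quasi h n w K \<xi> g x - axis_quasi h n w K \<xi> g y\<bar> \<le> 2 * (weight_norm n w * B) / h * \<bar>x - y\<bar>"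
proof (rule parameter_interval_cells[OF _ x y])
  obtain c where c: "\<forall>k\<in>K. \<xi> k = c + of_int k * h" using uniform_knots_affine[OF K] by blast
  fix j x y assume j: "j - int n \<in> K" "j + 1 + int n \<in> K"
    and x: "x \<in> {\<xi> j..\<xi> (j + 1)}" and y: "y \<in> {\<xi> j..\<xi> (j + 1)}"
  let ?x = "(x - c) / h" and ?y = "(y - c) / h"
  have xy: "of_int j \<le> ?x" "?x \<le> of_int j + 1" "of_int j \<le> ?y" "?y \<le> of_int j + 1"
    using cell_coordinate[OF c j] x y by auto
  have "\<bar>axis_quasi h n w K \<xi> g x - axis_quasi h n w K \<xi> g y\<bar> \<le> 2 * (weight_norm n w * B) * \<bar>?x - ?y\<bar>"
    unfolding axis_quasi_cell[OF c j x] axis_quasi_cell[OF c j y]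
    by (rule local_quasi_lipschitz[OF n xy]) (intro g cell_neighbourhood[OF c j])
  also have "\<bar>?x - ?y\<bar> = \<bar>x - y\<bar> / h"
    using h by (simp add: abs_divide diff_divide_distrib[symmetric])
  finally show "\<bar>axis_quasi h n w K \<xi> g x - axis_quasi h n w K \<xi> g y\<bar>
      \<le> 2 * (weight_norm n w * B) / h * \<bar>x - y\<bar>" by simp
next
  have "0 \<le> B" using x parameter_interval_subset_knot_hull[OF K] g[of x] by fastforce
  then show "0 \<le> 2 * (weight_norm n w * B) / h" using h by (simp add: sum_nonneg)
qed

context
  fixes diff :: "nat \<Rightarrow> real \<Rightarrow> real" and M :: real
  assumes w: "quasi_weights n w"
    and D: "\<And>m t. m \<le> n \<Longrightarrow> (diff m has_real_derivative diff (Suc m) t) (at t)"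
    and M: "\<And>t. t \<in> knot_hull K \<xi> \<Longrightarrow> \<bar>diff (Suc n) t\<bar> \<le> M"
begin

lemma
  assumes c: "\<forall>k\<in>K. \<xi> k = c + of_int k * h" and j: "j - int n \<in> K" "j + 1 + int n \<in> K"
  shows scaled_derivs: "m \<le> n \<Longrightarrow> ((\<lambda>y. h ^ m * diff m (c + y * h)) has_real_derivative
        h ^ Suc m * diff (Suc m) (c + y * h)) (at y)"
    and scaled_bound: "of_int j - real n \<le> y \<Longrightarrow> y \<le> of_int j + real n + 1 \<Longrightarrow>
        \<bar>h ^ Suc n * diff (Suc n) (c + y * h)\<bar> \<le> h ^ Suc n * M"
proof -
  assume "m \<le> n"
  have "((\<lambda>y. diff m (c + y * h)) has_real_derivative diff (Suc m) (c + y * h) * h) (at y)"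
    by (rule DERIV_chain2[OF D[OF \<open>m \<le> n\<close>]]) (auto intro!: derivative_eq_intros)
  from DERIV_cmult[OF this, of "h ^ m"]
  show "((\<lambda>y. h ^ m * diff m (c + y * h)) has_real_derivative h ^ Suc m * diff (Suc m) (c + y * h)) (at y)"
    by (simp add: mult_ac)
next
  assume "of_int j - real n \<le> y" "y \<le> of_int j + real n + 1"
  from cell_neighbourhood[OF c j this] show "\<bar>h ^ Suc n * diff (Suc n) (c + y * h)\<bar> \<le> h ^ Suc n * M"
    using h M by (simp add: abs_mult)
qed

lemma axis_quasi_error:
  assumes z: "z \<in> parameter_interval n K \<xi>"
  shows "\<bar>diff 0 z - axis_quasi h n w K \<xi> (diff 0) z\<bar>
     \<le> (1 + weight_norm n w) * (h ^ Suc n * M * (real n + 1/2) ^ Suc n / fact (Suc n))"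
proof -
  obtain c where c: "\<forall>k\<in>K. \<xi> k = c + of_int k * h" using uniform_knots_affine[OF K] by blast
  from z obtain j where j: "j - int n \<in> K" "j + 1 + int n \<in> K" "z \<in> {\<xi> j..\<xi> (j + 1)}"
    unfolding parameter_interval_def by blast
  have "of_int j \<le> (z - c) / h" "(z - c) / h \<le> of_int j + 1"
    using cell_coordinate[OF c j(1,2)] j(3) by auto
  from local_quasi_error[OF n w scaled_derivs[OF c j(1,2)] scaled_bound[OF c j(1,2)] this] 
  show ?thesis unfolding axis_quasi_cell[OF c j] using h by simp
qed

lemma axis_quasi_error_lipschitz:
  assumes x: "x \<in> parameter_interval n K \<xi>" and y: "y \<in> parameter_interval n K \<xi>"
  shows "\<bar>(diff 0 x - axis_quasi h n w K \<xi> (diff 0) x) - (diff 0 y - axis_quasi h n w K \<xi> (diff 0) y)\<bar>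
     \<le> (h ^ Suc n * M * (real n + 1/2) ^ n / fact n
        + 2 * (weight_norm n w * (h ^ Suc n * M * (real n + 1/2) ^ Suc n / fact (Suc n)))) / h * \<bar>x - y\<bar>"
    (is "_ \<le> ?L / h * _")
proof (rule parameter_interval_cells[OF _ x y])
  obtain c where c: "\<forall>k\<in>K. \<xi> k = c + of_int k * h" using uniform_knots_affine[OF K] by blast
  fix j x y assume j: "j - int n \<in> K" "j + 1 + int n \<in> K"
    and x: "x \<in> {\<xi> j..\<xi> (j + 1)}" and y: "y \<in> {\<xi> j..\<xi> (j + 1)}"
  let ?x = "(x - c) / h" and ?y = "(y - c) / h"
  have xy: "of_int j \<le> ?x" "?x \<le> of_int j + 1" "of_int j \<le> ?y" "?y \<le> of_int j + 1"
    using cell_coordinate[OF c j] x y by auto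
  have "\<bar>(diff 0 x - axis_quasi h n w K \<xi> (diff 0) x) - (diff 0 y - axis_quasi h n w K \<xi> (diff 0) y)\<bar>
    \<le> ?L * \<bar>?x - ?y\<bar>"
    using local_quasi_error_lipschitz[OF n w scaled_derivs[OF c j] scaled_bound[OF c j] xy] h
    unfolding axis_quasi_cell[OF c j x] axis_quasi_cell[OF c j y] by simp
  also have "\<bar>?x - ?y\<bar> = \<bar>x - y\<bar> / h"
    using h by (simp add: abs_divide diff_divide_distrib[symmetric])
  finally show "\<bar>(diff 0 x - axis_quasi h n w K \<xi> (diff 0) x) - (diff 0 y - axis_quasi h n w K \<xi> (diff 0) y)\<bar>
    \<le> ?L / h * \<bar>x - y\<bar>" by simp
next
  have "0 \<le> M" using x parameter_interval_subset_knot_hull[OF K] M[of x] by fastforce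
  then show "0 \<le> ?L / h" using h by (intro divide_nonneg_pos add_nonneg_nonneg mult_nonneg_nonneg) (auto simp: sum_nonneg)
qed

end

end

section \<open>Tensor products\<close>

text \<open>The Taylor remainder at distance \<open>(n + 1/2) h\<close>, relative to a bound for the derivative of
  order \<open>n + 1\<close>.\<close>

abbreviation taylor_factor :: "nat \<Rightarrow> real \<Rightarrow> real" where
  "taylor_factor n h \<equiv> h ^ Suc n * (real n + 1/2) ^ Suc n / fact (Suc n)"

text \<open>A bound for the slope of the error along an axis. The first summand in the parentheses is the
  slope of the Taylor remainder along that axis, the second one the slope of its image and of the
  images of the errors of the other axes. The factor \<open>4\<close> is \<open>2\<close> from the slope of a spline, times
  \<open>2\<close> from \<open>1 + \<Sum>v. \<bar>w v\<bar> \<le> 2 * (\<Sum>v. \<bar>w v\<bar>)\<close>.\<close>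

abbreviation error_slope ::
    "nat \<Rightarrow> real \<Rightarrow> (nat \<Rightarrow> real) \<Rightarrow> ('d::finite \<Rightarrow> real) \<Rightarrow> real" where
  "error_slope n h w M \<equiv>
     h ^ n * ((real n + 1/2) ^ n / fact n
       + 4 * weight_norm n w ^ CARD('d) * (real n + 1/2) ^ Suc n / fact (Suc n)) * (\<Sum>i\<in>UNIV. M i)"

definition coord_upd :: "real ^ 'd::finite \<Rightarrow> 'd \<Rightarrow> real \<Rightarrow> real ^ 'd" where
  "coord_upd x i t = (\<chi> l. if l = i then t else x $ l)"

lemma coord_upd_nth [simp]: "coord_upd x i t $ l = (if l = i then t else x $ l)"
  by (simp add: coord_upd_def)

lemma coord_upd_same [simp]: "coord_upd x i (x $ i) = x"
  by (simp add: vec_eq_iff)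

lemma coord_upd_upd [simp]: "coord_upd (coord_upd x i s) i t = coord_upd x i t"
  by (simp add: vec_eq_iff)

lemma coord_upd_in_mesh:
  "x \<in> mesh_rectangle K \<xi> \<Longrightarrow> t \<in> knot_hull (K i) (\<xi> i) \<Longrightarrow> coord_upd x i t \<in> mesh_rectangle K \<xi>"
  by (auto simp: mesh_rectangle_def box_product_def)

lemma parameter_rectangle_subset_mesh_rectangle:
  assumes K: "\<And>i. uniform_knots h (K i) (\<xi> i)"
  shows "parameter_rectangle n K \<xi> \<subseteq> mesh_rectangle K \<xi>"
  using parameter_interval_subset_knot_hull[OF K]
  by (auto simp: parameter_rectangle_def mesh_rectangle_def box_product_def)

text \<open>Quasi-interpolation in the coordinates of \<open>I\<close>, with the other coordinates left alone. For each
  axis the summation index is a pair of a knot index and the offset of a sample.\<close>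

definition partial_quasi ::
    "real \<Rightarrow> nat \<Rightarrow> (nat \<Rightarrow> real) \<Rightarrow> ('d::finite \<Rightarrow> int set) \<Rightarrow> ('d \<Rightarrow> int \<Rightarrow> real) \<Rightarrow> 'd set \<Rightarrow>
      (real ^ 'd \<Rightarrow> real) \<Rightarrow> real ^ 'd \<Rightarrow> real" where
  "partial_quasi h n w K \<xi> I f x =
     (\<Sum>s\<in>(\<Pi>\<^sub>E i\<in>I. active_indices n (K i) (\<xi> i) (x $ i) \<times> {..n}).
        (\<Prod>i\<in>I. bspline (\<xi> i) n (fst (s i)) (x $ i) * w (snd (s i))) *
        f (\<chi> i. if i \<in> I then \<xi> i (fst (s i) + int (snd (s i))) + h / 2 else x $ i))"

lemma partial_quasi_empty [simp]: "partial_quasi h n w K \<xi> {} f x = f x"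
  by (simp add: partial_quasi_def)

lemma axis_quasi_diff:
  "axis_quasi h n w K \<xi> (\<lambda>t. f t - g t) z = axis_quasi h n w K \<xi> f z - axis_quasi h n w K \<xi> g z"
  by (simp add: axis_quasi_def case_prod_unfold right_diff_distrib sum_subtractf)

text \<open>The axis operators can be peeled off in any order. Adding \<open>i\<close> makes its operator the outermost
  one.\<close>

lemma partial_quasi_insert:
  assumes "i \<notin> I"
  shows "partial_quasi h n w K \<xi> (insert i I) f x =
    axis_quasi h n w (K i) (\<xi> i) (\<lambda>t. partial_quasi h n w K \<xi> I f (coord_upd x i t)) (x $ i)"
proof -
  let ?T = "\<lambda>i. active_indices n (K i) (\<xi> i) (x $ i) \<times> {..n}"
  let ?a = "\<lambda>i s. bspline (\<xi> i) n (fst s) (x $ i) * w (snd s)"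
  let ?y = "\<lambda>i s. \<xi> i (fst s + int (snd s)) + h / 2"
  have "partial_quasi h n w K \<xi> (insert i I) f x =
     (\<Sum>(q, s)\<in>?T i \<times> Pi\<^sub>E I ?T. (\<Prod>l\<in>insert i I. ?a l ((s(i := q)) l)) *
        f (\<chi> l. if l \<in> insert i I then ?y l ((s(i := q)) l) else x $ l))"
    unfolding partial_quasi_def PiE_insert_eq
    by (subst sum.reindex) (use inj_combinator[OF assms] in \<open>auto simp: case_prod_unfold intro!: sum.cong\<close>)
  also have "\<dots> = (\<Sum>(q, s)\<in>?T i \<times> Pi\<^sub>E I ?T. ?a i q * ((\<Prod>l\<in>I. ?a l (s l)) *
        f (\<chi> l. if l \<in> I then ?y l (s l) else coord_upd x i (?y i q) $ l)))"
  proof (intro sum.cong refl, clarify)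
    fix q1 q2 and s :: "'a \<Rightarrow> int \<times> nat"
    have "(\<chi> l. if l \<in> insert i I then ?y l ((s(i := (q1, q2))) l) else x $ l) =
      (\<chi> l. if l \<in> I then ?y l (s l) else coord_upd x i (?y i (q1, q2)) $ l)"
      using assms by (auto simp: vec_eq_iff)
    moreover have "(\<Prod>l\<in>insert i I. ?a l ((s(i := (q1, q2))) l)) = ?a i (q1, q2) * (\<Prod>l\<in>I. ?a l (s l))"
      using assms by (subst prod.insert) (auto intro!: arg_cong2[where f = "(*)"] prod.cong)
    ultimately show "(\<Prod>l\<in>insert i I. ?a l ((s(i := (q1, q2))) l)) *
        f (\<chi> l. if l \<in> insert i I then ?y l ((s(i := (q1, q2))) l) else x $ l) =
      ?a i (q1, q2) * ((\<Prod>l\<in>I. ?a l (s l)) * f (\<chi> l. if l \<in> I then ?y l (s l) else coord_upd x i (?y i (q1, q2)) $ l))"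
      by (simp only: mult.assoc)
  qed
  also have "\<dots> = (\<Sum>q\<in>?T i. ?a i q * (\<Sum>s\<in>Pi\<^sub>E I ?T. (\<Prod>l\<in>I. ?a l (s l)) *
        f (\<chi> l. if l \<in> I then ?y l (s l) else coord_upd x i (?y i q) $ l)))"
    unfolding sum_distrib_left by (rule sum.cartesian_product[symmetric])
  also have "\<dots> = (\<Sum>q\<in>?T i. ?a i q * partial_quasi h n w K \<xi> I f (coord_upd x i (?y i q)))"
  proof (intro sum.cong refl arg_cong2[where f = "(*)"])
    fix q
    have "l \<in> I \<Longrightarrow> coord_upd x i (?y i q) $ l = x $ l" for l using assms by auto
    then show "(\<Sum>s\<in>Pi\<^sub>E I ?T. (\<Prod>l\<in>I. ?a l (s l)) * f (\<chi> l. if l \<in> I then ?y l (s l) else coord_upd x i (?y i q) $ l))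
      = partial_quasi h n w K \<xi> I f (coord_upd x i (?y i q))"
      unfolding partial_quasi_def
      by (intro sum.cong arg_cong2[where f = "(*)"] prod.cong PiE_cong refl) (simp_all del: coord_upd_nth)
  qed
  finally show ?thesis
    unfolding axis_quasi_def by (simp add: case_prod_unfold)
qed

context
  fixes h :: real and n :: nat and w :: "nat \<Rightarrow> real"
    and K :: "'d::finite \<Rightarrow> int set" and \<xi> :: "'d \<Rightarrow> int \<Rightarrow> real"
  assumes n: "1 \<le> n" and h: "0 < h" and K: "\<And>i. uniform_knots h (K i) (\<xi> i)" and w: "quasi_weights n w"
begin

text \<open>At a point of the parameter rectangle finitely many tensor products of B-splines do not vanish, so
  that the infinite sum is a finite one.\<close>

lemma quasi_interpolant_eq_partial_quasi:
  assumes x: "x \<in> parameter_rectangle n K \<xi>"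
  shows "quasi_interpolant h n w K \<xi> f x = partial_quasi h n w K \<xi> UNIV f x"
proof -
  let ?A = "\<lambda>i. active_indices n (K i) (\<xi> i) (x $ i)"
  let ?F = "\<lambda>k. quasi_functional h n w \<xi> k f * tensor_bspline \<xi> n k x"
  have fin: "finite (?A i)" for i
    using x by (intro finite_active_indices[OF n h K]) (auto simp: parameter_rectangle_def box_product_def)
  have "quasi_interpolant h n w K \<xi> f x = infsum ?F (Pi\<^sub>E UNIV ?A)"
    unfolding quasi_interpolant_def
  proof (rule infsum_cong_neutral)
    fix k assume "k \<in> {k. \<forall>i. k i \<in> bspline_indices n (K i)} - Pi\<^sub>E UNIV ?A"
    then obtain i where "bspline (\<xi> i) n (k i) (x $ i) = 0"
      by (auto simp: PiE_UNIV_domain active_indices_def)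
    then show "?F k = 0" unfolding tensor_bspline_def by (subst prod_zero) auto
  qed (auto simp: PiE_UNIV_domain active_indices_def)
  also have "\<dots> = (\<Sum>k\<in>Pi\<^sub>E UNIV ?A. ?F k)"
    by (intro infsum_finite finite_PiE fin) simp
  also have "\<dots> = (\<Sum>k\<in>Pi\<^sub>E UNIV ?A. \<Sum>v\<in>{v. \<forall>i. v i \<le> n}.
      (\<Prod>i\<in>UNIV. bspline (\<xi> i) n (k i) (x $ i) * w (v i)) * f (\<chi> i. \<xi> i (k i + int (v i)) + h / 2))"
    unfolding quasi_functional_def tensor_bspline_def sum_distrib_right prod.distrib
    by (simp add: mult_ac)
  also have "\<dots> = partial_quasi h n w K \<xi> UNIV f x"
    unfolding partial_quasi_def sum.cartesian_product
    by (rule sum.reindex_bij_witness[of _ "\<lambda>s. (fst \<circ> s, snd \<circ> s)" "\<lambda>(k, v) i. (k i, v i)"])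
       (auto simp: PiE_UNIV_domain Pi_iff mem_Times_iff)
  finally show ?thesis .
qed

context
  fixes f :: "real ^ 'd \<Rightarrow> real" and M :: "'d \<Rightarrow> real"
  assumes deriv: "\<And>i m x t. m \<le> n \<Longrightarrow>
      ((\<lambda>t. (partial_deriv i ^^ m) f (coord_upd x i t)) has_real_derivative
        (partial_deriv i ^^ Suc m) f (coord_upd x i t)) (at t)"
    and M: "\<And>i x. x \<in> mesh_rectangle K \<xi> \<Longrightarrow> \<bar>(partial_deriv i ^^ Suc n) f x\<bar> \<le> M i"
begin

lemma derivative_bound_nonneg: "x \<in> mesh_rectangle K \<xi> \<Longrightarrow> 0 \<le> M i"
  using M[of x i] by linarith

text \<open>The factor \<open>1 + \<Sum>v. \<bar>w v\<bar>\<close> of the one-variable estimate is replaced by \<open>2 * (\<Sum>v. \<bar>w v\<bar>)\<close>, which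
  combines with the powers of the other axes.\<close>

lemma axis_error:
  assumes "x \<in> mesh_rectangle K \<xi>" "x $ i \<in> parameter_interval n (K i) (\<xi> i)"
  shows "\<bar>f x - axis_quasi h n w (K i) (\<xi> i) (\<lambda>t. f (coord_upd x i t)) (x $ i)\<bar> \<le> 2 * weight_norm n w * taylor_factor n h * M i"
proof -
  have "\<bar>f x - axis_quasi h n w (K i) (\<xi> i) (\<lambda>t. f (coord_upd x i t)) (x $ i)\<bar>
    \<le> (1 + weight_norm n w) * (h ^ Suc n * M i * (real n + 1/2) ^ Suc n / fact (Suc n))"
    using axis_quasi_error[OF n h K w, where diff = "\<lambda>m t. (partial_deriv i ^^ m) f (coord_upd x i t)", OF deriv M assms(2)]
      coord_upd_in_mesh[OF assms(1), of _ i] by simp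
  also have "\<dots> = (1 + weight_norm n w) * (taylor_factor n h * M i)" by (simp add: mult_ac)
  also have "\<dots> \<le> (2 * weight_norm n w) * (taylor_factor n h * M i)"
    using sum_abs_weights_ge_1[OF n w] derivative_bound_nonneg[OF assms(1), of i] h
    by (intro mult_right_mono mult_nonneg_nonneg) auto
  finally show ?thesis by (simp add: mult_ac)
qed

text \<open>Coordinates outside \<open>I\<close> may range over the whole mesh rectangle. The induction needs this:
  the outermost operator evaluates the error of the others at sample points, which can lie outside
  the parameter rectangle.\<close>

lemma partial_quasi_error:
  assumes "x \<in> mesh_rectangle K \<xi>" "\<And>i. i \<in> I \<Longrightarrow> x $ i \<in> parameter_interval n (K i) (\<xi> i)"
  shows "\<bar>f x - partial_quasi h n w K \<xi> I f x\<bar> \<le> 2 * weight_norm n w ^ card I * taylor_factor n h * (\<Sum>i\<in>I. M i)"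
  using finite[of I] assms
proof (induction I arbitrary: x rule: finite_induct)
  case (insert i I)
  let ?Q = "axis_quasi h n w (K i) (\<xi> i)"
  let ?e = "\<lambda>t. f (coord_upd x i t) - partial_quasi h n w K \<xi> I f (coord_upd x i t)"
  note W1 = sum_abs_weights_ge_1[OF n w]
  have xi: "x $ i \<in> parameter_interval n (K i) (\<xi> i)" using insert.prems by auto
  have "f x - partial_quasi h n w K \<xi> (insert i I) f x =
      (f x - ?Q (\<lambda>t. f (coord_upd x i t)) (x $ i)) + ?Q ?e (x $ i)"
    unfolding partial_quasi_insert[OF insert.hyps(2)] axis_quasi_diff by simp
  moreover have "\<bar>f x - ?Q (\<lambda>t. f (coord_upd x i t)) (x $ i)\<bar> \<le> 2 * weight_norm n w ^ card (insert i I) * taylor_factor n h * M i"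
  proof -
    have "weight_norm n w ^ 1 \<le> weight_norm n w ^ card (insert i I)"
      using W1 insert.hyps by (intro power_increasing) auto
    then have "2 * weight_norm n w * (taylor_factor n h * M i) \<le> 2 * weight_norm n w ^ card (insert i I) * (taylor_factor n h * M i)"
      using derivative_bound_nonneg[OF insert.prems(1), of i] h
      by (intro mult_right_mono mult_nonneg_nonneg) auto
    then show ?thesis using axis_error[OF insert.prems(1) xi] by (simp only: mult.assoc)
  qed
  moreover have "\<bar>?Q ?e (x $ i)\<bar> \<le> weight_norm n w * (2 * weight_norm n w ^ card I * taylor_factor n h * (\<Sum>i\<in>I. M i))"
  proof (rule axis_quasi_bound[OF n h K xi])
    fix t assume t: "t \<in> knot_hull (K i) (\<xi> i)"
    show "\<bar>?e t\<bar> \<le> 2 * weight_norm n w ^ card I * taylor_factor n h * (\<Sum>i\<in>I. M i)"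
      by (rule insert.IH) (use insert t in \<open>auto intro: coord_upd_in_mesh\<close>)
  qed
  ultimately have "\<bar>f x - partial_quasi h n w K \<xi> (insert i I) f x\<bar>
      \<le> 2 * weight_norm n w ^ card (insert i I) * taylor_factor n h * M i + weight_norm n w * (2 * weight_norm n w ^ card I * taylor_factor n h * (\<Sum>i\<in>I. M i))"
    by linarith
  also have "\<dots> = 2 * weight_norm n w ^ card (insert i I) * taylor_factor n h * (\<Sum>i\<in>insert i I. M i)"
    using insert.hyps by (simp add: distrib_left)
  finally show ?case .
qed simp

lemma quasi_interpolant_error:
  assumes x: "x \<in> parameter_rectangle n K \<xi>"
  shows "\<bar>f x - quasi_interpolant h n w K \<xi> f x\<bar> \<le> 2 * weight_norm n w ^ CARD('d) * taylor_factor n h * (\<Sum>i\<in>UNIV. M i)"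
  unfolding quasi_interpolant_eq_partial_quasi[OF x]
  by (rule partial_quasi_error)
     (use x parameter_rectangle_subset_mesh_rectangle[where K = K and \<xi> = \<xi>, OF K] in \<open>auto simp: parameter_rectangle_def box_product_def\<close>)

text \<open>With the operator of axis \<open>i\<close> outermost, the error is the one-variable error along that axis
  plus the image of the error of all other axes. That image is a spline in the moving coordinate with
  coefficients of order \<open>h\<^bsup>n + 1\<^esup>\<close>, whose slope is of order \<open>h\<^sup>n\<close>.\<close>

lemma quasi_interpolant_error_coord_lipschitz:
  assumes x: "x \<in> parameter_rectangle n K \<xi>" and t: "t \<in> parameter_interval n (K i) (\<xi> i)"
  shows "\<bar>(f x - quasi_interpolant h n w K \<xi> f x)
     - (f (coord_upd x i t) - quasi_interpolant h n w K \<xi> f (coord_upd x i t))\<bar>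
     \<le> error_slope n h w M * \<bar>x $ i - t\<bar>"
proof -
  let ?y = "coord_upd x i t" and ?I = "- {i}"
  let ?Q = "axis_quasi h n w (K i) (\<xi> i)"
  let ?\<phi> = "\<lambda>s. f (coord_upd x i s)"
  let ?e = "\<lambda>s. ?\<phi> s - partial_quasi h n w K \<xi> ?I f (coord_upd x i s)"
  let ?B = "2 * weight_norm n w ^ (CARD('d) - 1) * taylor_factor n h * (\<Sum>l\<in>?I. M l)"
  have y: "?y \<in> parameter_rectangle n K \<xi>"
    using x t by (auto simp: parameter_rectangle_def box_product_def)
  have xS: "x \<in> mesh_rectangle K \<xi>" using x parameter_rectangle_subset_mesh_rectangle[where K = K and \<xi> = \<xi>, OF K] by auto
  have xi: "x $ i \<in> parameter_interval n (K i) (\<xi> i)" using x by (auto simp: parameter_rectangle_def box_product_def)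
  have univ: "UNIV = insert i ?I" by auto
  have split: "f z - quasi_interpolant h n w K \<xi> f z = (?\<phi> (z $ i) - ?Q ?\<phi> (z $ i)) + ?Q ?e (z $ i)"
    if "z \<in> parameter_rectangle n K \<xi>" "\<And>s. coord_upd z i s = coord_upd x i s" for z
  proof -
    have "?\<phi> (z $ i) = f z" using that(2)[of "z $ i"] by (metis coord_upd_same)
    moreover have "quasi_interpolant h n w K \<xi> f z = ?Q (\<lambda>s. partial_quasi h n w K \<xi> ?I f (coord_upd x i s)) (z $ i)"
      unfolding quasi_interpolant_eq_partial_quasi[OF that(1)] that(2)[symmetric]
      by (subst univ, rule partial_quasi_insert) simp
    ultimately show ?thesis unfolding axis_quasi_diff by simp
  qed
  have split_y: "f ?y - quasi_interpolant h n w K \<xi> f ?y = (?\<phi> t - ?Q ?\<phi> t) + ?Q ?e t"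
  proof -
    have "?y $ i = t" by simp
    then show ?thesis using split[OF y coord_upd_upd] by metis
  qed
  have "\<bar>(?\<phi> (x $ i) - ?Q ?\<phi> (x $ i)) - (?\<phi> t - ?Q ?\<phi> t)\<bar>
     \<le> (h ^ Suc n * M i * (real n + 1/2) ^ n / fact n
        + 2 * (weight_norm n w * (h ^ Suc n * M i * (real n + 1/2) ^ Suc n / fact (Suc n)))) / h * \<bar>x $ i - t\<bar>"
    using axis_quasi_error_lipschitz[OF n h K w, where diff = "\<lambda>m t. (partial_deriv i ^^ m) f (coord_upd x i t)", OF deriv M xi t]
      coord_upd_in_mesh[OF xS, of _ i] by simp
  moreover have "\<bar>?Q ?e (x $ i) - ?Q ?e t\<bar> \<le> 2 * (weight_norm n w * ?B) / h * \<bar>x $ i - t\<bar>"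
  proof (rule axis_quasi_lipschitz[OF n h K xi t])
    fix s assume s: "s \<in> knot_hull (K i) (\<xi> i)"
    have "\<bar>?e s\<bar> \<le> 2 * weight_norm n w ^ card ?I * taylor_factor n h * (\<Sum>l\<in>?I. M l)"
      by (rule partial_quasi_error)
         (use x s in \<open>auto intro!: coord_upd_in_mesh xS simp: parameter_rectangle_def box_product_def\<close>)
    moreover have "card ?I = CARD('d) - 1" by (simp add: card_Diff_singleton Compl_eq_Diff_UNIV)
    ultimately show "\<bar>?e s\<bar> \<le> ?B" by simp
  qed
  ultimately have "\<bar>(f x - quasi_interpolant h n w K \<xi> f x) - (f ?y - quasi_interpolant h n w K \<xi> f ?y)\<bar>
     \<le> ((h ^ Suc n * M i * (real n + 1/2) ^ n / fact n
        + 2 * (weight_norm n w * (h ^ Suc n * M i * (real n + 1/2) ^ Suc n / fact (Suc n)))) / h + 2 * (weight_norm n w * ?B) / h) * \<bar>x $ i - t\<bar>"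
    unfolding split[OF x refl] split_y distrib_right by linarith
  also have "\<dots> \<le> error_slope n h w M * \<bar>x $ i - t\<bar>"
  proof (rule mult_right_mono)
    define r where "r = (real n + 1/2) ^ n / fact n"
    define q where "q = (real n + 1/2) ^ Suc n / fact (Suc n)"
    have rq: "0 \<le> r" "0 \<le> q" by (auto simp: r_def q_def)
    define P where "P = weight_norm n w ^ CARD('d)"
    have WP: "weight_norm n w * weight_norm n w ^ (CARD('d) - 1) = P" unfolding P_def by (rule power_minus_mult[of "CARD('d)" "weight_norm n w", unfolded mult.commute[of _ "weight_norm n w"]]) simp
    have "weight_norm n w ^ 1 \<le> P" unfolding P_def using sum_abs_weights_ge_1[OF n w] by (intro power_increasing) (auto simp: Suc_le_eq)
    then have W2: "2 * weight_norm n w \<le> 4 * P" using sum_abs_weights_ge_1[OF n w] by simp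
    have M0: "0 \<le> M l" for l by (rule derivative_bound_nonneg[OF xS])
    have sumM: "(\<Sum>l\<in>UNIV. M l) = M i + (\<Sum>l\<in>?I. M l)"
      by (subst univ, rule sum.insert) auto
    have "(h ^ Suc n * M i * (real n + 1/2) ^ n / fact n
        + 2 * (weight_norm n w * (h ^ Suc n * M i * (real n + 1/2) ^ Suc n / fact (Suc n)))) / h + 2 * (weight_norm n w * ?B) / h
       = h ^ n * (M i * r + 2 * weight_norm n w * (M i * q) + 4 * (weight_norm n w * weight_norm n w ^ (CARD('d) - 1)) * (q * (\<Sum>l\<in>?I. M l)))"
    proof -
      have e: "h ^ Suc n * M i * (real n + 1/2) ^ n / fact n = h * (h ^ n * (M i * r))"
        "h ^ Suc n * M i * (real n + 1/2) ^ Suc n / fact (Suc n) = h * (h ^ n * (M i * q))"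
        "taylor_factor n h = h * (h ^ n * q)"
        unfolding r_def q_def power_Suc[of h] by simp_all
      show ?thesis unfolding e using h by (simp add: field_simps)
    qed
    also have "\<dots> \<le> h ^ n * ((M i + (\<Sum>l\<in>?I. M l)) * r + 4 * P * (M i * q) + 4 * P * (q * (\<Sum>l\<in>?I. M l)))"
      unfolding WP using h rq W2 M0
      by (intro mult_left_mono add_mono mult_right_mono order_refl) (auto simp: sum_nonneg)
    also have "\<dots> = error_slope n h w M"
      unfolding sumM P_def[symmetric] r_def q_def by (simp add: algebra_simps add_divide_distrib del: fact_Suc power_Suc)
    finally show "(h ^ Suc n * M i * (real n + 1/2) ^ n / fact n
        + 2 * (weight_norm n w * (h ^ Suc n * M i * (real n + 1/2) ^ Suc n / fact (Suc n)))) / h + 2 * (weight_norm n w * ?B) / h \<le> error_slope n h w M" .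
  qed simp
  finally show ?thesis .
qed

text \<open>Changing the coordinates one at a time stays inside the parameter rectangle, and the \<open>l\<^sup>1\<close> norm of
  \<open>x - y\<close> is at most \<open>\<surd>d\<close> times its Euclidean norm.\<close>

lemma quasi_interpolant_error_lipschitz:
  assumes x: "x \<in> parameter_rectangle n K \<xi>" and y: "y \<in> parameter_rectangle n K \<xi>"
  shows "\<bar>(f x - quasi_interpolant h n w K \<xi> f x) - (f y - quasi_interpolant h n w K \<xi> f y)\<bar>
     \<le> error_slope n h w M * (sqrt (real CARD('d)) * norm (x - y))"
proof -
  let ?E = "\<lambda>z. f z - quasi_interpolant h n w K \<xi> f z"
  let ?z = "\<lambda>I. (\<chi> i. if i \<in> I then x $ i else y $ i)"
  have "\<bar>?E (?z I) - ?E y\<bar> \<le> (\<Sum>i\<in>I. error_slope n h w M * \<bar>x $ i - y $ i\<bar>)" for I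
    using finite[of I]
  proof (induction I rule: finite_induct)
    case empty
    have "?z {} = y" by (simp add: vec_eq_iff)
    then show ?case by simp
  next
    case (insert i I)
    have "?z I = coord_upd (?z (insert i I)) i (y $ i)" using insert.hyps by (auto simp: vec_eq_iff)
    moreover have "?z (insert i I) \<in> parameter_rectangle n K \<xi>" "y $ i \<in> parameter_interval n (K i) (\<xi> i)"
      using x y by (auto simp: parameter_rectangle_def box_product_def)
    note quasi_interpolant_error_coord_lipschitz[OF this]
    ultimately have "\<bar>?E (?z (insert i I)) - ?E (?z I)\<bar> \<le> error_slope n h w M * \<bar>x $ i - y $ i\<bar>" by simp
    then show ?case using insert.IH unfolding sum.insert[OF insert.hyps] by linarith
  qed
  from this[of UNIV] have "\<bar>?E x - ?E y\<bar> \<le> error_slope n h w M * (\<Sum>i\<in>UNIV. \<bar>x $ i - y $ i\<bar>)"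
    by (simp add: sum_distrib_left)
  also have "\<dots> \<le> error_slope n h w M * (sqrt (real CARD('d)) * norm (x - y))"
  proof (rule mult_left_mono)
    have "(\<Sum>i\<in>UNIV. \<bar>(x - y) $ i\<bar>) = (\<Sum>i\<in>UNIV. \<bar>1 :: real\<bar> * \<bar>(x - y) $ i\<bar>)" by simp
    also have "\<dots> \<le> L2_set (\<lambda>_. 1) (UNIV :: 'd set) * L2_set (\<lambda>i. (x - y) $ i) UNIV"
      by (rule L2_set_mult_ineq)
    also have "\<dots> = sqrt (real CARD('d)) * norm (x - y)"
      by (simp add: L2_set_def norm_vec_def)
    finally show "(\<Sum>i\<in>UNIV. \<bar>x $ i - y $ i\<bar>) \<le> sqrt (real CARD('d)) * norm (x - y)" by simp
    have "x \<in> mesh_rectangle K \<xi>" using x parameter_rectangle_subset_mesh_rectangle[where K = K and \<xi> = \<xi>, OF K] by auto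
    then show "0 \<le> error_slope n h w M"
      using h derivative_bound_nonneg
      by (intro mult_nonneg_nonneg sum_nonneg) (auto simp: sum_nonneg)
  qed
  finally show ?thesis .
qed

end

end

section \<open>Partial derivatives\<close>

lemma times_cont_diff_partial_deriv_power:
  "times_cont_diff (m + k) f \<Longrightarrow> times_cont_diff k ((partial_deriv i ^^ m) f)"
proof (induction m arbitrary: k)
  case (Suc m)
  have "times_cont_diff (Suc k) ((partial_deriv i ^^ m) f)"
    using Suc.IH[of "Suc k"] Suc.prems by (simp only: add_Suc add_Suc_right)
  then show ?case by simp
qed simp

lemma DERIV_along_axis:
  assumes "\<And>x. g differentiable at x"
  shows "((\<lambda>t. g (coord_upd x i t)) has_real_derivative partial_deriv i g (coord_upd x i t)) (at t)"
proof -
  have eq: "coord_upd x i = (\<lambda>t. x + (t - x $ i) *\<^sub>R axis i 1)"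
    by (rule ext) (auto simp: vec_eq_iff axis_def)
  have "((\<lambda>t. x + (t - x $ i) *\<^sub>R axis i 1) has_derivative (\<lambda>s. s *\<^sub>R axis i 1)) (at t)"
    by (auto intro!: derivative_eq_intros)
  moreover have D: "(g has_derivative frechet_derivative g (at (coord_upd x i t))) (at (coord_upd x i t))"
    unfolding frechet_derivative_works[symmetric] by (rule assms)
  ultimately have "((\<lambda>t. g (coord_upd x i t)) has_derivative
      (\<lambda>s. frechet_derivative g (at (coord_upd x i t)) (s *\<^sub>R axis i 1))) (at t)"
    unfolding eq by (rule has_derivative_compose)
  moreover have "frechet_derivative g (at (coord_upd x i t)) (s *\<^sub>R axis i 1) = partial_deriv i g (coord_upd x i t) * s" for s
    using linear_cmul[OF has_derivative_linear[OF D]] by (simp add: partial_deriv_def)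
  ultimately show ?thesis unfolding has_field_derivative_def by simp
qed

lemma frechet_derivative_eq_gradient:
  assumes "f differentiable at x"
  shows "frechet_derivative f (at x) u = gradient f x \<bullet> u"
proof -
  have lin: "linear (frechet_derivative f (at x))"
    using assms by (rule linear_frechet_derivative)
  have "frechet_derivative f (at x) u = frechet_derivative f (at x) (\<Sum>i\<in>UNIV. u $ i *\<^sub>R axis i 1)"
    using basis_expansion[of u] by (simp add: scalar_mult_eq_scaleR)
  also have "\<dots> = gradient f x \<bullet> u"
    by (simp add: linear_sum[OF lin] linear_cmul[OF lin] gradient_def partial_deriv_def inner_vec_def mult.commute)
  finally show ?thesis .
qed

lemma lipschitz_of_gradient_bound:
  assumes "\<And>x. f differentiable at x" "\<And>x. norm (gradient f x) \<le> L"
  shows "\<bar>f x - f y\<bar> \<le> L * norm (x - y)"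
proof -
  have "norm (f x - f y) \<le> L * norm (x - y)"
  proof (rule differentiable_bound[where S = UNIV and f' = "\<lambda>x. frechet_derivative f (at x)"])
    fix x
    show "(f has_derivative frechet_derivative f (at x)) (at x)"
      using assms(1)[of x] unfolding frechet_derivative_works .
    show "onorm (frechet_derivative f (at x)) \<le> L"
    proof (rule onorm_le)
      fix u
      have "norm (frechet_derivative f (at x) u) \<le> norm (gradient f x) * norm u"
        unfolding frechet_derivative_eq_gradient[OF assms(1)] real_norm_def by (rule Cauchy_Schwarz_ineq2)
      also have "\<dots> \<le> L * norm u" using assms(2) by (rule mult_right_mono) simp
      finally show "norm (frechet_derivative f (at x) u) \<le> L * norm u" .
    qed
  qed auto
  then show ?thesis by simp
qed

section \<open>Essential suprema over the mesh rectangle\<close>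

lemma AE_lebesgue_on_open_witness:
  fixes S :: "'a::euclidean_space set"
  assumes "S \<in> sets lebesgue" "open V" "V \<noteq> {}" "V \<subseteq> S" "AE y in lebesgue_on S. P y"
  shows "\<exists>y\<in>V. P y"
proof (rule ccontr)
  assume no: "\<not> (\<exists>y\<in>V. P y)"
  have "AE y in lebesgue. y \<in> S \<longrightarrow> P y"
    using assms(1,5) by (subst AE_restrict_space_iff[symmetric]) auto
  then have "AE y in lebesgue. y \<notin> V" by eventually_elim (use no assms(4) in auto)
  then have "V \<in> null_sets lebesgue"
    using assms(2) by (subst AE_iff_null_sets) auto
  then show False using assms(2,3) by (simp add: negligible_iff_null_sets[symmetric] open_not_negligible)
qed

lemma Linf_norm_nonneg:
  assumes "S \<in> sets lebesgue" "open V" "V \<noteq> {}" "V \<subseteq> S"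
  shows "0 \<le> Linf_norm S g"
proof -
  have "AE y in lebesgue_on S. ereal \<bar>g y\<bar> \<le> Linf_norm S g"
    unfolding Linf_norm_def by (rule esssup_AE)
  from AE_lebesgue_on_open_witness[OF assms this] obtain y where "ereal \<bar>g y\<bar> \<le> Linf_norm S g" by blast
  moreover have "0 \<le> ereal \<bar>g y\<bar>" by simp
  ultimately show ?thesis by (rule order_trans[rotated])
qed

text \<open>The value of a continuous function at a point is almost attained on a neighbourhood, which
  meets the interior of \<open>S\<close> in a set of positive measure.\<close>

lemma sup_norm_le_Linf_norm:
  assumes S: "S \<in> sets lebesgue" "S \<subseteq> closure (interior S)" and g: "continuous_on UNIV g"
  shows "sup_norm S g \<le> Linf_norm S g"
  unfolding sup_norm_def
proof (rule SUP_least, rule ccontr)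
  fix x assume x: "x \<in> S" "\<not> ereal \<bar>g x\<bar> \<le> Linf_norm S g"
  let ?U = "{y. Linf_norm S g < ereal \<bar>g y\<bar>}"
  have "continuous_on UNIV (\<lambda>y. ereal \<bar>g y\<bar>)"
    using g by (intro continuous_on_ereal continuous_intros)
  then have U: "open ?U" by (intro open_Collect_less continuous_on_const)
  moreover have "x \<in> ?U" "x \<in> closure (interior S)" using x S by auto
  ultimately have "?U \<inter> interior S \<noteq> {}" by (auto simp: closure_iff_nhds_not_empty)
  moreover have "open (?U \<inter> interior S)" "?U \<inter> interior S \<subseteq> S"
    using U interior_subset by blast+
  moreover have "AE y in lebesgue_on S. ereal \<bar>g y\<bar> \<le> Linf_norm S g"
    unfolding Linf_norm_def by (rule esssup_AE)
  ultimately show False using AE_lebesgue_on_open_witness[OF S(1)] by (metis (mono_tags, lifting) IntD1 mem_Collect_eq not_le)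
qed

text \<open>Each point of the mesh rectangle lies in a product of closed knot intervals of positive length,
  which is the closure of its interior.\<close>

lemma mesh_rectangle_regular:
  assumes h: "0 < h" and K: "\<And>i. uniform_knots h (K i) (\<xi> i)"
  shows "closed (mesh_rectangle K \<xi>)" "mesh_rectangle K \<xi> \<subseteq> closure (interior (mesh_rectangle K \<xi>))"
proof -
  have "closed (knot_hull (K i) (\<xi> i))" for i
  proof (cases "K i = UNIV")
    case True
    have "knot_hull UNIV (\<xi> i) = parameter_interval 0 UNIV (\<xi> i)"
      by (simp add: knot_hull_def parameter_interval_def)
    then show ?thesis using True K[of i] h parameter_interval_infinite[of h "\<xi> i" 0] by simp
  next
    case False
    then have "finite (K i)" using K[of i] by (auto simp: uniform_knots_def)
    then have "finite {k. k \<in> K i \<and> k + 1 \<in> K i}" by (rule finite_subset[rotated]) auto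
    then show ?thesis unfolding knot_hull_def by (intro closed_UN) auto
  qed
  then show "closed (mesh_rectangle K \<xi>)"
    unfolding mesh_rectangle_def box_product_def
    by (intro closed_Collect_all) (auto intro!: closed_vimage[unfolded vimage_def] continuous_intros)
  show "mesh_rectangle K \<xi> \<subseteq> closure (interior (mesh_rectangle K \<xi>))"
  proof
    fix x assume x: "x \<in> mesh_rectangle K \<xi>"
    have "\<exists>k. k \<in> K i \<and> k + 1 \<in> K i \<and> x $ i \<in> {\<xi> i k..\<xi> i (k + 1)}" for i
      using x by (auto simp: mesh_rectangle_def box_product_def knot_hull_def)
    then obtain k where k: "\<And>i. k i \<in> K i" "\<And>i. k i + 1 \<in> K i" "\<And>i. x $ i \<in> {\<xi> i (k i)..\<xi> i (k i + 1)}"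
      by metis
    let ?a = "\<chi> i. \<xi> i (k i)" and ?b = "\<chi> i. \<xi> i (k i + 1)"
    have ab: "\<xi> i (k i) < \<xi> i (k i + 1)" for i
      using K[of i] k(1,2)[of i] h by (auto simp: uniform_knots_def)
    have "cbox ?a ?b \<subseteq> mesh_rectangle K \<xi>"
      using k by (fastforce simp: mem_box_cart mesh_rectangle_def box_product_def knot_hull_def)
    then have "box ?a ?b \<subseteq> interior (mesh_rectangle K \<xi>)"
      using box_subset_cbox by (intro interior_maximal) auto
    moreover have "closure (box ?a ?b) = cbox ?a ?b"
      using ab by (intro closure_box) (simp add: interval_ne_empty_cart)
    moreover have "x \<in> cbox ?a ?b" using k(3) by (auto simp: mem_box_cart)
    ultimately show "x \<in> closure (interior (mesh_rectangle K \<xi>))" using closure_mono by blast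
  qed
qed

lemma finite_multi_indices: "finite (multi_indices m :: ('d::finite \<Rightarrow> nat) set)"
proof (rule finite_subset)
  show "(multi_indices m :: ('d \<Rightarrow> nat) set) \<subseteq> Pi\<^sub>E UNIV (\<lambda>_. {..m})"
  proof
    fix \<alpha> :: "'d \<Rightarrow> nat" assume "\<alpha> \<in> multi_indices m"
    then have "\<alpha> i \<le> m" for i
      using member_le_sum[of i UNIV \<alpha>] by (simp add: multi_indices_def)
    then show "\<alpha> \<in> Pi\<^sub>E UNIV (\<lambda>_. {..m})" by auto
  qed
qed (intro finite_PiE, auto)

lemma pure_multi_index: "(\<lambda>i. if i = v then m else 0) \<in> multi_indices m"
  by (simp add: multi_indices_def)

text \<open>The order of differentiation is determined: only one list has all its entries equal to
  \<open>v\<close> and length \<open>m\<close>.\<close>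

lemma multi_deriv_pure:
  "multi_deriv (\<lambda>i. if i = v then m else 0) f = (partial_deriv v ^^ m) f"
proof -
  have "is = replicate m v" if "\<forall>i. count_list is i = (if i = v then m else 0)" for "is" :: "'a list"
  proof -
    have "set is \<subseteq> {v}" using that by (metis count_list_0_iff insert_iff subsetI)
    then have "is = replicate (length is) v" by (metis replicate_eqI singletonD subsetD)
    moreover have "count_list (replicate k v) v = k" for k by (induction k) auto
    ultimately show ?thesis using that by metis
  qed
  moreover have "count_list (replicate m v) i = (if i = v then m else 0)" for i by (induction m) auto
  ultimately have "(SOME is. \<forall>i. count_list is i = (if i = v then m else 0)) = replicate m v"
    by (intro some_equality) auto
  moreover have "foldr partial_deriv (replicate m v) f = (partial_deriv v ^^ m) f" by (induction m) auto
  ultimately show ?thesis by (simp add: multi_deriv_def)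
qed

lemma sum_sup_norm_le_W_inf_seminorm:
  fixes f :: "real ^ 'd::finite \<Rightarrow> real"
  assumes S: "S \<in> sets lebesgue" "S \<subseteq> closure (interior S)" "S \<noteq> {}"
    and "0 < m" and cont: "\<And>v. continuous_on UNIV ((partial_deriv v ^^ m) f)"
  shows "(\<Sum>v\<in>UNIV. sup_norm S ((partial_deriv v ^^ m) f)) \<le> W_inf_seminorm m S f"
proof -
  let ?e = "\<lambda>v i :: 'd. if i = v then m else 0"
  have V: "open (interior S)" "interior S \<noteq> {}" "interior S \<subseteq> S"
    using S interior_subset by auto
  have "(\<Sum>v\<in>UNIV. sup_norm S ((partial_deriv v ^^ m) f)) \<le> (\<Sum>v\<in>UNIV. Linf_norm S (multi_deriv (?e v) f))"
    unfolding multi_deriv_pure by (intro sum_mono sup_norm_le_Linf_norm S cont)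
  also have "\<dots> = (\<Sum>\<alpha>\<in>range ?e. Linf_norm S (multi_deriv \<alpha> f))"
  proof (subst sum.reindex)
    show "inj ?e" using \<open>0 < m\<close> by (intro injI) (metis less_numeral_extra(3))
  qed simp
  also have "\<dots> \<le> W_inf_seminorm m S f"
    unfolding W_inf_seminorm_def
    by (intro sum_mono2 finite_multi_indices Linf_norm_nonneg[OF S(1) V]) (auto intro: pure_multi_index)
  finally show ?thesis .
qed

section \<open>Lower bounds for the constants\<close>

lemma quasi_norm_eq: "quasi_norm TYPE('d::finite) n w = weight_norm n w ^ CARD('d)"
proof -
  have "quasi_norm TYPE('d) n w = (\<Sum>v\<in>Pi\<^sub>E (UNIV :: 'd set) (\<lambda>_. {..n}). \<Prod>i\<in>UNIV. \<bar>w (v i)\<bar>)"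
    unfolding quasi_norm_def abs_prod by (intro sum.cong) (auto simp: PiE_UNIV_domain)
  also have "\<dots> = (\<Prod>i\<in>(UNIV :: 'd set). \<Sum>v\<le>n. \<bar>w v\<bar>)"
    by (rule prod_sum_PiE[symmetric]) auto
  finally show ?thesis by simp
qed

text \<open>The summand \<open>v = 1\<close> alone gives the bound, as \<open>c\<^sub>1(n) \<ge> 0\<close>.\<close>

lemma c_const_ge:
  assumes "1 \<le> d"
  shows "1 / (2 ^ n * fact (n + 1)) \<le> c_const n d p"
proof -
  have c1: "0 \<le> c1_const n p"
    unfolding c1_const_def
  proof (intro sum_nonneg mult_nonneg_nonneg)
    fix k
    show "0 \<le> integral {0..1} (\<lambda>x. \<bar>poly (p k) x\<bar>)"
      by (intro integral_nonneg integrable_continuous_interval continuous_intros) auto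
    have "bounded ((\<lambda>x. \<bar>poly (p k) x\<bar>) ` {0..1})"
      by (intro compact_imp_bounded compact_continuous_image continuous_intros) auto
    then have "\<bar>poly (p k) 0\<bar> \<le> (SUP x\<in>{0..1}. \<bar>poly (p k) x\<bar>)"
      by (intro cSUP_upper bounded_imp_bdd_above) auto
    then show "0 \<le> (SUP x\<in>{0..1}. \<bar>poly (p k) x\<bar>)" by linarith
  qed
  have "c1_const n p ^ (1 - 1) \<le> (\<Sum>v=1..d. c1_const n p ^ (v - 1))"
    using assms c1 by (intro member_le_sum) auto
  moreover have "1 / (2 ^ n * fact (n + 1)) \<le> c2_const n p"
    unfolding c2_const_def using c1 by (intro divide_right_mono) auto
  ultimately have "1 / (2 ^ n * fact (n + 1)) * 1 \<le> c2_const n p * (\<Sum>v=1..d. c1_const n p ^ (v - 1))"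
    by (intro mult_mono order_trans[OF _ \<open>1 / (2 ^ n * fact (n + 1)) \<le> c2_const n p\<close>]) auto
  then show ?thesis by (simp add: c_const_def)
qed

lemma C_BH_nonneg: "0 \<le> C_BH TYPE('d::finite) n j"
  unfolding C_BH_def by (intro mult_nonneg_nonneg real_sqrt_ge_zero sum_nonneg) auto

text \<open>A pure multi-index \<open>\<beta>\<close> contributes \<open>1 / ((n + 1 - j)!)\<^sup>2\<close> to the sum under the root, and
  \<open>(n + 1 - j) / (n + 1 - j)! = 1 / (n - j)!\<close>.\<close>

lemma C_BH_ge:
  assumes "j \<le> n"
  shows "1 / fact (n - j) \<le> C_BH TYPE('d::finite) n j"
proof -
  let ?m = "n + 1 - j"
  fix v0 :: 'd
  let ?e = "\<lambda>m i :: 'd. if i = v0 then m else 0"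
  have "{?e j} \<subseteq> multi_indices j" using pure_multi_index[of v0 j] by simp
  from card_mono[OF finite_multi_indices this]
  have 1: "1 \<le> real (card (multi_indices j :: ('d \<Rightarrow> nat) set))" by simp
  have mf: "multi_fact (?e ?m) = fact ?m"
    unfolding multi_fact_def by (subst prod.remove[of _ v0]) auto
  have "1 / (multi_fact (?e ?m))\<^sup>2 \<le> (\<Sum>\<beta>\<in>(multi_indices ?m :: ('d \<Rightarrow> nat) set). 1 / (multi_fact \<beta>)\<^sup>2)"
    by (rule member_le_sum[OF pure_multi_index _ finite_multi_indices]) simp
  then have "(1 / fact ?m)\<^sup>2 \<le> (\<Sum>\<beta>\<in>(multi_indices ?m :: ('d \<Rightarrow> nat) set). 1 / (multi_fact \<beta>)\<^sup>2)"
    unfolding mf by (simp add: power_divide)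
  then have 2: "1 / fact ?m \<le> sqrt (\<Sum>\<beta>\<in>(multi_indices ?m :: ('d \<Rightarrow> nat) set). 1 / (multi_fact \<beta>)\<^sup>2)"
    by (rule real_le_rsqrt)
  have "1 / fact (n - j) = 1 * real ?m * (1 / fact ?m)"
    using assms by (simp add: Suc_diff_le del: of_nat_Suc)
  also have "\<dots> \<le> C_BH TYPE('d) n j"
    unfolding C_BH_def by (intro mult_mono 1 2) auto
  finally show ?thesis .
qed

section \<open>The logarithm of the quasi-interpolant\<close>

lemma abs_ln_diff_le:
  fixes u v m :: real
  assumes "0 < m" "m \<le> u" "m \<le> v"
  shows "\<bar>ln u - ln v\<bar> \<le> \<bar>u - v\<bar> / m"
proof -
  have le: "ln a - ln b \<le> \<bar>a - b\<bar> / m" if "m \<le> a" "m \<le> b" for a b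
  proof -
    have "ln a - ln b \<le> (a - b) / b" using that assms(1) by (intro ln_diff_le) auto
    also have "\<dots> \<le> \<bar>a - b\<bar> / m" using that assms(1) by (intro frac_le) auto
    finally show ?thesis .
  qed
  show ?thesis using le[OF assms(2,3)] le[OF assms(3,2)] by (auto simp: abs_le_iff abs_minus_commute)
qed

lemma sup_norm_nonneg: "S \<noteq> {} \<Longrightarrow> 0 \<le> sup_norm S g"
  unfolding sup_norm_def by (auto intro: SUP_upper2)

text \<open>The radius \<open>(n + 1/2) h\<close> is half of the side length \<open>(2 n + 1) h\<close>, which gains \<open>2\<^bsup>n + 1\<^esup>\<close>; one factor
  \<open>2\<close> of it pays for the \<open>2\<close> in front, the others occur in the bound for \<open>c(n, d)\<close>.\<close>

lemma C2_coefficient_ge: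
  fixes w :: "nat \<Rightarrow> real"
  assumes h: "0 \<le> h"
  shows "2 * weight_norm n w ^ CARD('d::finite) * (h ^ Suc n * (real n + 1/2) ^ Suc n / fact (Suc n))
     \<le> c_const n CARD('d) p * quasi_norm TYPE('d) n w * real (2 * n + 1) ^ (n + 1) * h ^ (n + 1)"
proof -
  have half: "(real n + 1/2) ^ Suc n = real (2 * n + 1) ^ Suc n / 2 ^ Suc n"
  proof -
    have "real n + 1/2 = real (2 * n + 1) / 2" by simp
    then show ?thesis by (simp only: power_divide)
  qed
  have "2 * weight_norm n w ^ CARD('d) * (h ^ Suc n * (real n + 1/2) ^ Suc n / fact (Suc n))
    = 1 / (2 ^ n * fact (n + 1)) * (weight_norm n w ^ CARD('d) * real (2 * n + 1) ^ (n + 1) * h ^ (n + 1))"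
    unfolding half by simp
  also have "\<dots> \<le> c_const n CARD('d) p * (weight_norm n w ^ CARD('d) * real (2 * n + 1) ^ (n + 1) * h ^ (n + 1))"
    by (intro mult_right_mono c_const_ge) (use h in \<open>auto simp: sum_nonneg Suc_leI\<close>)
  finally show ?thesis by (simp only: quasi_norm_eq mult.assoc)
qed

text \<open>Summand by summand: \<open>C\<^bsub>BH, 1\<^esub> \<ge> 1 / (n - 1)!\<close> and \<open>C\<^bsub>BH, 0\<^esub> \<ge> 1 / n!\<close>, the powers of \<open>d\<close> are at least
  \<open>1\<close>, and \<open>2\<^bsup>n + 1\<^esup> \<ge> 4\<close> absorbs the \<open>4\<close>.\<close>

lemma C1_coefficient_ge:
  fixes w :: "nat \<Rightarrow> real"
  assumes n: "1 \<le> n"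
  shows "(real n + 1/2) ^ n / fact n + 4 * weight_norm n w ^ CARD('d::finite) * (real n + 1/2) ^ Suc n / fact (Suc n)
     \<le> C_BH TYPE('d) n 1 * real (2 * n + 1) ^ n * real CARD('d) powr (real n / 2) +
        2 * quasi_norm TYPE('d) n w * C_BH TYPE('d) n 0 * real (2 * n + 1) ^ (n + 1) *
          real CARD('d) powr (real (n + 1) / 2)"
proof (rule add_mono)
  have d: "1 \<le> real CARD('d) powr (real k / 2)" for k
    by (rule ge_one_powr_ge_zero) (simp_all add: Suc_leI)
  have base: "(real n + 1/2) ^ k \<le> real (2 * n + 1) ^ k" for k
    by (rule power_mono) auto
  have f: "1 / fact n \<le> (1 / fact (n - 1) :: real)"
    by (intro divide_left_mono fact_mono) auto
  have "(real n + 1/2) ^ n / fact n = 1 / fact n * (real n + 1/2) ^ n * 1" by simp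
  also have "\<dots> \<le> C_BH TYPE('d) n 1 * real (2 * n + 1) ^ n * real CARD('d) powr (real n / 2)"
    by (intro mult_mono d base order_trans[OF f C_BH_ge[OF n]] mult_nonneg_nonneg C_BH_nonneg) auto
  finally show "(real n + 1/2) ^ n / fact n \<le> C_BH TYPE('d) n 1 * real (2 * n + 1) ^ n * real CARD('d) powr (real n / 2)" .
  have half: "(real n + 1/2) ^ Suc n = real (2 * n + 1) ^ Suc n / 2 ^ Suc n"
  proof -
    have "real n + 1/2 = real (2 * n + 1) / 2" by simp
    then show ?thesis by (simp only: power_divide)
  qed
  have C0: "1 / fact n \<le> C_BH TYPE('d) n 0" using C_BH_ge[of 0 n] by simp
  have "(2::real) ^ 1 \<le> 2 ^ n" using n by (intro power_increasing) auto
  then have "4 / (2 ^ Suc n * fact (Suc n)) \<le> 4 / (4 * fact n :: real)"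
    by (intro divide_left_mono mult_mono fact_mono) auto
  also have "\<dots> \<le> 2 * C_BH TYPE('d) n 0"
    using C0 order_trans[OF _ C0, of 0] by simp
  finally have c: "4 / (2 ^ Suc n * fact (Suc n)) \<le> 2 * C_BH TYPE('d) n 0" .
  have W0: "0 \<le> weight_norm n w ^ CARD('d)" by (simp add: sum_nonneg)
  have "4 * weight_norm n w ^ CARD('d) * (real n + 1/2) ^ Suc n / fact (Suc n)
      = 4 / (2 ^ Suc n * fact (Suc n)) * (weight_norm n w ^ CARD('d) * real (2 * n + 1) ^ Suc n) * 1"
    unfolding half by (simp del: fact_Suc power_Suc add: mult_ac)
  also have "\<dots> \<le> 2 * C_BH TYPE('d) n 0 * (weight_norm n w ^ CARD('d) * real (2 * n + 1) ^ Suc n) *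
      real CARD('d) powr (real (n + 1) / 2)"
    using W0 order_trans[OF _ C0, of 0] by (intro mult_mono c d mult_nonneg_nonneg order_refl) auto
  also have "\<dots> = 2 * quasi_norm TYPE('d) n w * C_BH TYPE('d) n 0 * real (2 * n + 1) ^ (n + 1) *
          real CARD('d) powr (real (n + 1) / 2)"
    by (simp only: quasi_norm_eq mult_ac Suc_eq_plus1)
  finally show "4 * weight_norm n w ^ CARD('d) * (real n + 1/2) ^ Suc n / fact (Suc n) \<le>
      2 * quasi_norm TYPE('d) n w * C_BH TYPE('d) n 0 * real (2 * n + 1) ^ (n + 1) *
          real CARD('d) powr (real (n + 1) / 2)" .
qed

text \<open>The coefficient of the norms in \<open>C\<^sub>2\<close> is positive, so an infinite norm would make \<open>C\<^sub>2\<close> infinite.\<close>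

lemma finite_sup_norms_of_C2:
  fixes f :: "real ^ 'd::finite \<Rightarrow> real"
  assumes n: "1 \<le> n" and h: "0 < h" and w: "quasi_weights n w" and S: "S \<noteq> {}"
    and C2: "C2 n w p S f * ereal (h ^ (n + 1)) < ereal A"
  shows "\<exists>M. \<forall>v. sup_norm S ((partial_deriv v ^^ (n + 1)) f) = ereal (M v)"
proof -
  let ?s = "\<lambda>v. sup_norm S ((partial_deriv v ^^ (n + 1)) f)"
  let ?a = "c_const n CARD('d) p * quasi_norm TYPE('d) n w * real (2 * n + 1) ^ (n + 1)"
  have "0 < (1 :: real) / (2 ^ n * fact (n + 1))" by simp
  also have "\<dots> \<le> c_const n CARD('d) p" by (rule c_const_ge) (simp add: Suc_leI)
  finally have "0 < c_const n CARD('d) p" .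
  moreover have "0 < quasi_norm TYPE('d) n w"
    unfolding quasi_norm_eq using sum_abs_weights_ge_1[OF n w] by simp
  ultimately have a: "0 < ?a" by simp
  have fin: "?s v \<noteq> \<infinity>" for v
  proof
    assume "?s v = \<infinity>"
    moreover have "(\<Sum>v\<in>{v}. ?s v) \<le> (\<Sum>v\<in>UNIV. ?s v)"
      by (intro sum_mono2 sup_norm_nonneg[OF S]) auto
    ultimately have "(\<Sum>v\<in>UNIV. ?s v) = \<infinity>" by simp
    moreover have "ereal r * \<infinity> = \<infinity>" if "0 < r" for r
      using that by simp
    ultimately have "C2 n w p S f = \<infinity>" unfolding C2_def using a by (simp only:)
    then show False using C2 h by simp
  qed
  have "?s v = ereal (real_of_ereal (?s v))" for v
    using fin[of v] sup_norm_nonneg[OF S, of "(partial_deriv v ^^ (n + 1)) f"] by (cases "?s v") auto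
  then show ?thesis by (intro exI[of _ "\<lambda>v. real_of_ereal (?s v)"]) blast
qed

theorem theorem3p4:
  fixes f :: "real ^ 'd::finite \<Rightarrow> real"
    and n :: nat
    and A B D h :: real
    and K :: "'d \<Rightarrow> int set"
    and \<xi> :: "'d \<Rightarrow> int \<Rightarrow> real"
    and w :: "nat \<Rightarrow> real"
    and p :: "nat \<Rightarrow> real poly"
  defines "R \<equiv> parameter_rectangle n K \<xi>"
    and "S \<equiv> mesh_rectangle K \<xi>"
    and "Qf \<equiv> quasi_interpolant h n w K \<xi> f"
  assumes "n \<ge> 1"
    and "times_cont_diff (n + 1) f"
    and "A > 0" "B > 0" "D > 0"
    and "\<And>x. A \<le> f x \<and> f x \<le> B"
    and "\<And>x. norm (gradient f x) \<le> D * \<bar>f x\<bar>"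
    and "h > 0"
    and "\<And>i. uniform_knots h (K i) (\<xi> i)"
    and "\<And>i. parameter_interval n (K i) (\<xi> i) \<noteq> {}"
    and "quasi_weights n w"
    and "orthonormal_poly_basis n p"
    and "C2 n w p S f * ereal (h ^ (n + 1)) < ereal A"
  shows "(\<forall>x\<in>R. Qf x > 0) \<and>
    (\<forall>x\<in>R. \<forall>y\<in>R. ereal \<bar>ln (Qf x) - ln (Qf y)\<bar> \<le>
       (ereal (D * B) + C1 n w S f * ereal (h ^ n)) / (ereal A - C2 n w p S f * ereal (h ^ (n + 1))) *
       ereal (norm (x - y)))"
proof -
  note n = \<open>n \<ge> 1\<close> and f = \<open>times_cont_diff (n + 1) f\<close> and h = \<open>h > 0\<close> and w = \<open>quasi_weights n w\<close>
    and K = \<open>\<And>i. uniform_knots h (K i) (\<xi> i)\<close> and C2 = \<open>C2 n w p S f * ereal (h ^ (n + 1)) < ereal A\<close>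
  let ?a = "c_const n CARD('d) p * quasi_norm TYPE('d) n w * real (2 * n + 1) ^ (n + 1)"
  let ?b = "C_BH TYPE('d) n 1 * real (2 * n + 1) ^ n * real CARD('d) powr (real n / 2) +
        2 * quasi_norm TYPE('d) n w * C_BH TYPE('d) n 0 * real (2 * n + 1) ^ (n + 1) *
          real CARD('d) powr (real (n + 1) / 2)"
  note RS = parameter_rectangle_subset_mesh_rectangle[where n = n and K = K and \<xi> = \<xi>, OF K, folded R_def S_def]
  have "\<exists>t. \<forall>i. t i \<in> parameter_interval n (K i) (\<xi> i)"
    using assms(13) by (intro choice) blast
  then obtain t where "\<And>i. t i \<in> parameter_interval n (K i) (\<xi> i)" by blast
  then have "(\<chi> i. t i) \<in> R" by (simp add: R_def parameter_rectangle_def box_product_def)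
  then have S_ne: "S \<noteq> {}" using RS by auto
  obtain M where M: "\<And>v. sup_norm S ((partial_deriv v ^^ (n + 1)) f) = ereal (M v)"
    using finite_sup_norms_of_C2[OF n h w S_ne C2] by blast
  have M_bound: "\<bar>(partial_deriv v ^^ Suc n) f x\<bar> \<le> M v" if "x \<in> mesh_rectangle K \<xi>" for v x
  proof -
    have "ereal \<bar>(partial_deriv v ^^ (n + 1)) f x\<bar> \<le> sup_norm S ((partial_deriv v ^^ (n + 1)) f)"
      unfolding sup_norm_def using that by (intro SUP_upper) (simp add: S_def)
    then show ?thesis unfolding M by simp
  qed
  define m where "m = (\<Sum>v\<in>UNIV. M v)"
  have m0: "0 \<le> m"
    unfolding m_def
  proof (rule sum_nonneg)
    fix v
    have "0 \<le> ereal (M v)" unfolding M[symmetric] by (rule sup_norm_nonneg[OF S_ne])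
    then show "0 \<le> M v" by simp
  qed
  have deriv: "((\<lambda>t. (partial_deriv i ^^ k) f (coord_upd x i t)) has_real_derivative
        (partial_deriv i ^^ Suc k) f (coord_upd x i t)) (at t)" if "k \<le> n" for i k x t
  proof -
    have "times_cont_diff (k + Suc (n - k)) f" using f that by simp
    then have "times_cont_diff (Suc (n - k)) ((partial_deriv i ^^ k) f)"
      by (rule times_cont_diff_partial_deriv_power)
    then have "\<And>x. (partial_deriv i ^^ k) f differentiable at x" by simp
    from DERIV_along_axis[OF this] show ?thesis by simp
  qed
  have E: "\<bar>f x - Qf x\<bar> \<le> 2 * weight_norm n w ^ CARD('d) * taylor_factor n h * m" if "x \<in> R" for x
    using quasi_interpolant_error[where f = f and M = M and K = K and \<xi> = \<xi>, OF n h K w deriv M_bound] that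
    unfolding R_def Qf_def m_def by blast
  have E_lip: "\<bar>(f x - Qf x) - (f y - Qf y)\<bar> \<le>
      h ^ n * ((real n + 1/2) ^ n / fact n + 4 * weight_norm n w ^ CARD('d) * (real n + 1/2) ^ Suc n / fact (Suc n)) * m *
        (sqrt (real CARD('d)) * norm (x - y))" if "x \<in> R" "y \<in> R" for x y
    using quasi_interpolant_error_lipschitz[where f = f and M = M and K = K and \<xi> = \<xi>, OF n h K w deriv M_bound] that
    unfolding R_def Qf_def m_def by blast

  have C2_eq: "C2 n w p S f * ereal (h ^ (n + 1)) = ereal (?a * h ^ (n + 1) * m)"
    unfolding C2_def M m_def by (simp add: mult_ac)
  define \<mu> where "\<mu> = A - ?a * h ^ (n + 1) * m"
  have \<mu>: "0 < \<mu>" using C2 unfolding C2_eq \<mu>_def by simp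
  have Q_ge: "\<mu> \<le> Qf x" if "x \<in> R" for x
  proof -
    have "\<bar>f x - Qf x\<bar> \<le> ?a * h ^ (n + 1) * m"
      using h m0 by (intro order_trans[OF E[OF that]] mult_right_mono C2_coefficient_ge) auto
    moreover have "A \<le> f x" using assms(9) by blast
    ultimately show ?thesis unfolding \<mu>_def by linarith
  qed

  define L where "L = D * B + sqrt (real CARD('d)) * ?b * h ^ n * m"
  have Q_lip: "\<bar>Qf x - Qf y\<bar> \<le> L * norm (x - y)" if xy: "x \<in> R" "y \<in> R" for x y
  proof -
    have "\<bar>f x - f y\<bar> \<le> D * B * norm (x - y)"
    proof (rule lipschitz_of_gradient_bound)
      show "f differentiable at x" for x using f by simp
      show "norm (gradient f x) \<le> D * B" for x
        using assms(10)[of x] assms(9)[of x] \<open>A > 0\<close> \<open>D > 0\<close>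
        by (intro order_trans[OF assms(10)] mult_left_mono) auto
    qed
    moreover have "\<bar>(f x - Qf x) - (f y - Qf y)\<bar> \<le> h ^ n * ?b * m * (sqrt (real CARD('d)) * norm (x - y))"
      by (rule order_trans[OF E_lip[OF xy]], intro mult_right_mono mult_left_mono C1_coefficient_ge n)
         (use h m0 in auto)
    ultimately show ?thesis unfolding L_def by (simp add: algebra_simps)
  qed
  have C1_ge: "ereal L \<le> ereal (D * B) + C1 n w S f * ereal (h ^ n)"
  proof -
    have "ereal m = (\<Sum>v\<in>UNIV. sup_norm S ((partial_deriv v ^^ (n + 1)) f))"
      unfolding M m_def by simp
    also have "\<dots> \<le> W_inf_seminorm (n + 1) S f"
    proof (rule sum_sup_norm_le_W_inf_seminorm)
      show "S \<in> sets lebesgue" "S \<subseteq> closure (interior S)"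
        unfolding S_def using mesh_rectangle_regular[where K = K and \<xi> = \<xi>, OF h K] by auto
      show "continuous_on UNIV ((partial_deriv v ^^ (n + 1)) f)" for v
        using times_cont_diff_partial_deriv_power[of "n + 1" 0 f v] f by simp
    qed (use S_ne in auto)
    finally have seminorm: "ereal m \<le> W_inf_seminorm (n + 1) S f" .
    have b0: "0 \<le> ?b"
      by (rule order_trans[OF _ C1_coefficient_ge[OF n]]) (simp add: sum_nonneg)
    have "ereal (sqrt (real CARD('d)) * ?b * h ^ n * m)
        = ereal (sqrt (real CARD('d)) * ?b) * ereal m * ereal (h ^ n)"
      by (simp add: mult_ac)
    also have "\<dots> \<le> C1 n w S f * ereal (h ^ n)"
      unfolding C1_def using b0 h
      by (intro ereal_mult_right_mono ereal_mult_left_mono seminorm) auto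
    finally show ?thesis unfolding L_def plus_ereal.simps(1)[symmetric] by (rule add_left_mono)
  qed

  show ?thesis
  proof (intro conjI ballI)
    fix x assume "x \<in> R"
    then show "Qf x > 0" using Q_ge \<mu> by fastforce
  next
    fix x y assume xy: "x \<in> R" "y \<in> R"
    have "\<bar>ln (Qf x) - ln (Qf y)\<bar> \<le> \<bar>Qf x - Qf y\<bar> / \<mu>"
      by (rule abs_ln_diff_le[OF \<mu> Q_ge[OF xy(1)] Q_ge[OF xy(2)]])
    also have "\<dots> \<le> L * norm (x - y) / \<mu>"
      using \<mu> by (intro divide_right_mono Q_lip xy) auto
    finally have "ereal \<bar>ln (Qf x) - ln (Qf y)\<bar> \<le> ereal L / ereal \<mu> * ereal (norm (x - y))"
      using \<mu> by simp
    also have "\<dots> \<le> (ereal (D * B) + C1 n w S f * ereal (h ^ n)) / ereal \<mu> * ereal (norm (x - y))"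
      using \<mu> by (intro ereal_mult_right_mono ereal_divide_right_mono C1_ge) auto
    also have "ereal \<mu> = ereal A - C2 n w p S f * ereal (h ^ (n + 1))"
      unfolding C2_eq \<mu>_def by simp
    finally show "ereal \<bar>ln (Qf x) - ln (Qf y)\<bar> \<le>
       (ereal (D * B) + C1 n w S f * ereal (h ^ n)) / (ereal A - C2 n w p S f * ereal (h ^ (n + 1))) *
       ereal (norm (x - y))" .
  qed
qed

end
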